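(* There is a normal Lie subgroup of the symmetry Lie group of the three dimensional Euler equations of gas dynamics (system (E) in the context) which is isomorphic to the Galilean group of $\mathbb R^4$: $$\mathrm{Gal}(4,\mathbb R)=\left\{\begin{pmatrix}1&\mathbf 0&s\\ \mathbf v&\mathbf R&\mathbf y\\ 0&\mathbf 0&1\end{pmatrix}\;\Big|\;\mathbf R\in \mathrm O(3,\mathbb R),\ s\in\mathbb R,\ \mathbf y,\mathbf v\in\mathbb R^3\right\}.$$ Therefore, the system (E) is invariant up to Galilean motions of the space-time $\mathbb R^4$.
   Context: The system (E), for unknown functions $u,v,w$ (velocity components), $p$ (pressure), $q$ (density) of $(t,x,y,z)$, with $\gamma\in\mathbb R$ the adiabatic index, is $$\begin{aligned} &u_t+uu_x+vu_y+wu_z+\tfrac1q p_x=0,\quad v_t+uv_x+vv_y+wv_z+\tfrac1q p_y=0,\\ &w_t+uw_x+vw_y+ww_z+\tfrac1q p_z=0,\quad q_t+q(u_x+v_y+w_z)+uq_x+vq_y+wq_z=0,\\ &p_t+\gamma p(u_x+v_y+w_z)+up_x+vp_y+wp_z=0. \end{aligned}$$ The symmetry Lie group of (E) is its full Lie point symmetry group, i.e. the Lie group of transformations of the space with coordinates $(t,x,y,z,u,v,w,p,q)$ mapping solutions of (E) to solutions of (E). Its Lie algebra $\mathfrak g$ is spanned by $$\begin{aligned} X_1&=\partial_x,\quad X_2=\partial_y,\quad X_3=\partial_z,\quad X_4=\partial_t,\\ X_5&=t\,\partial_x+\partial_u,\quad X_6=t\,\partial_y+\partial_v,\quad X_7=t\,\partial_z+\partial_w,\\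 X_8&=t\,\partial_t-u\,\partial_u-v\,\partial_v-w\,\partial_w+2q\,\partial_q,\\ X_9&=x\,\partial_x+y\,\partial_y+z\,\partial_z+u\,\partial_u+v\,\partial_v+w\,\partial_w-2q\,\partial_q,\\ X_{10}&=y\,\partial_x-x\,\partial_y+v\,\partial_u-u\,\partial_v,\quad X_{11}=-z\,\partial_y+y\,\partial_z-w\,\partial_v+v\,\partial_w,\\ X_{12}&=-z\,\partial_x+x\,\partial_z-w\,\partial_u+u\,\partial_w,\quad X_{13}=q\,\partial_q+p\,\partial_p. \end{aligned}$$ The phrase "invariant up to Galilean motions of the space-time $\mathbb R^4$" means that the Galilean group acts by symmetries of (E) through this subgroup. *)

theory Defs
  imports "HOL-Analysis.Analysis" "HOL-Algebra.Coset"
begin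

text \<open>Smooth (infinitely differentiable) maps.\<close>

primrec Ck_on :: "nat \<Rightarrow> 'a::euclidean_space set \<Rightarrow> ('a \<Rightarrow> 'b::real_normed_vector) \<Rightarrow> bool" where
  "Ck_on 0 W f \<longleftrightarrow> continuous_on W f"
| "Ck_on (Suc k) W f \<longleftrightarrow>
     (\<forall>x\<in>W. f differentiable (at x)) \<and> (\<forall>d. Ck_on k W (\<lambda>x. frechet_derivative f (at x) d))"

text \<open>On a set that need not be open, smoothness means that there are local smooth extensions to
  open sets. For an embedded submanifold of a Euclidean space (such as a closed matrix group) this
  is smoothness with respect to the manifold structure.\<close>

definition smooth_on :: "'a::euclidean_space set \<Rightarrow> ('a \<Rightarrow> 'b::real_normed_vector) \<Rightarrow> bool" where
  "smooth_on S f \<longleftrightarrow> (\<forall>x\<in>S. \<exists>W g. open W \<and> x \<in> W \<and> (\<forall>k. Ck_on k W g) \<and> (\<forall>y\<in>S \<inter> W. g y = f y))"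


text \<open>The coordinates \<open>(t,x,y,z)\<close> and \<open>(u,v,w,p,q)\<close> are grouped as \<open>(t, x)\<close> and \<open>(u, p, q)\<close>, where
  position \<open>x\<close> and velocity \<open>u\<close> are vectors.\<close>

type_synonym spacetime = "real \<times> (real^3)"
type_synonym state = "(real^3) \<times> real \<times> real"
type_synonym phase = "spacetime \<times> state"

definition D_t :: "(spacetime \<Rightarrow> real) \<Rightarrow> spacetime \<Rightarrow> real" where
  "D_t f e = frechet_derivative f (at e) (1, 0)"

definition D_x :: "3 \<Rightarrow> (spacetime \<Rightarrow> real) \<Rightarrow> spacetime \<Rightarrow> real" where
  "D_x j f e = frechet_derivative f (at e) (0, axis j 1)"

definition euler_equations ::
  "real \<Rightarrow> (spacetime \<Rightarrow> real^3) \<Rightarrow> (spacetime \<Rightarrow> real) \<Rightarrow> (spacetime \<Rightarrow> real) \<Rightarrow> spacetime \<Rightarrow> bool" where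
  "euler_equations \<gamma> u p q e \<longleftrightarrow>
     (\<forall>i. D_t (\<lambda>e. u e $ i) e + (\<Sum>j\<in>UNIV. u e $ j * D_x j (\<lambda>e. u e $ i) e)
            + 1 / q e * D_x i p e = 0) \<and>
     D_t q e + q e * (\<Sum>j\<in>UNIV. D_x j (\<lambda>e. u e $ j) e)
            + (\<Sum>j\<in>UNIV. u e $ j * D_x j q e) = 0 \<and>
     D_t p e + \<gamma> * p e * (\<Sum>j\<in>UNIV. D_x j (\<lambda>e. u e $ j) e)
            + (\<Sum>j\<in>UNIV. u e $ j * D_x j p e) = 0"

text \<open>Solutions are local: \<open>U\<close> is an arbitrary open set. The condition \<open>q \<noteq> 0\<close> makes the term
  \<open>1/q\<close> meaningful.\<close>

definition euler_solution :: "real \<Rightarrow> spacetime set \<Rightarrow> (spacetime \<Rightarrow> state) \<Rightarrow> bool" where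
  "euler_solution \<gamma> U f \<longleftrightarrow> open U \<and> smooth_on U f \<and>
     (\<forall>e\<in>U. snd (snd (f e)) \<noteq> 0 \<and>
        euler_equations \<gamma> (\<lambda>e. fst (f e)) (\<lambda>e. fst (snd (f e))) (\<lambda>e. snd (snd (f e))) e)"

definition solution_graphs :: "real \<Rightarrow> phase set set" where
  "solution_graphs \<gamma> = {(\<lambda>e. (e, f e)) ` U | U f. euler_solution \<gamma> U f}"


definition diffeomorphism :: "('m::euclidean_space \<Rightarrow> 'm) \<Rightarrow> bool" where
  "diffeomorphism \<phi> \<longleftrightarrow> bij \<phi> \<and> smooth_on UNIV \<phi> \<and> smooth_on UNIV (inv_into UNIV \<phi>)"

text \<open>A point transformation acts on solutions through their graphs. The equivalence says that both
  \<open>\<phi>\<close> and its inverse map solutions to solutions.\<close>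

definition symmetry_group :: "real \<Rightarrow> (phase \<Rightarrow> phase) monoid" where
  "symmetry_group \<gamma> =
     \<lparr>carrier = {\<phi>. diffeomorphism \<phi> \<and>
                     (\<forall>S. \<phi> ` S \<in> solution_graphs \<gamma> \<longleftrightarrow> S \<in> solution_graphs \<gamma>)},
      mult = (\<circ>), one = id\<rparr>"


text \<open>A group of diffeomorphisms carries the smooth structure for which a family of
  transformations is smooth iff its joint evaluation map is. Its Lie algebra consists of the
  infinitesimal generators of its smooth one-parameter subgroups.\<close>

definition smooth_curve :: "(real \<Rightarrow> 'm::euclidean_space \<Rightarrow> 'm) \<Rightarrow> bool" where
  "smooth_curve c \<longleftrightarrow> smooth_on UNIV (\<lambda>(s, m). c s m)"

definition lie_algebra :: "('m::euclidean_space \<Rightarrow> 'm) monoid \<Rightarrow> ('m \<Rightarrow> 'm) set" where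
  "lie_algebra G = {X. \<exists>c. smooth_curve c \<and> (\<forall>s. c s \<in> carrier G) \<and>
     (\<forall>r s. c (r + s) = c r \<otimes>\<^bsub>G\<^esub> c s) \<and>
     (\<forall>m. ((\<lambda>s. c s m) has_vector_derivative X m) (at 0))}"

text \<open>\<open>\<Theta>\<close> is a group isomorphism from a matrix Lie group \<open>H\<close> onto a group \<open>N\<close> of diffeomorphisms
  that is smooth and has a smooth inverse; smoothness of the inverse is tested on smooth curves
  (Boman). If \<open>N\<close> is a subgroup of a Lie transformation group \<open>G\<close>, it is thereby an embedded Lie
  subgroup of \<open>G\<close>: its smooth curves are those of \<open>G\<close> that lie in \<open>N\<close>, and its Lie group structure
  is that of \<open>H\<close>.\<close>

definition lie_group_iso ::
  "(real^'n^'n) monoid \<Rightarrow> ('m::euclidean_space \<Rightarrow> 'm) monoid \<Rightarrow> (real^'n^'n \<Rightarrow> 'm \<Rightarrow> 'm) \<Rightarrow> bool" where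
  "lie_group_iso H N \<Theta> \<longleftrightarrow> \<Theta> \<in> iso H N \<and>
     smooth_on (carrier H \<times> UNIV) (\<lambda>(A, m). \<Theta> A m) \<and>
     (\<forall>c. (\<forall>s. c s \<in> carrier H) \<and> smooth_curve (\<lambda>s. \<Theta> (c s)) \<longrightarrow> smooth_on UNIV c)"


text \<open>Space translations, time translation, Galilean boosts, two scalings, infinitesimal rotations,
  and the joint scaling of density and pressure.\<close>

definition euler_fields :: "(phase \<Rightarrow> phase) list" where
  "euler_fields =
    [\<lambda>((t, x), (u, p, q)). ((0, axis 1 1), (0, 0, 0)),
     \<lambda>((t, x), (u, p, q)). ((0, axis 2 1), (0, 0, 0)),
     \<lambda>((t, x), (u, p, q)). ((0, axis 3 1), (0, 0, 0)),
     \<lambda>((t, x), (u, p, q)). ((1, 0), (0, 0, 0)),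
     \<lambda>((t, x), (u, p, q)). ((0, axis 1 t), (axis 1 1, 0, 0)),
     \<lambda>((t, x), (u, p, q)). ((0, axis 2 t), (axis 2 1, 0, 0)),
     \<lambda>((t, x), (u, p, q)). ((0, axis 3 t), (axis 3 1, 0, 0)),
     \<lambda>((t, x), (u, p, q)). ((t, 0), (- u, 0, 2 * q)),
     \<lambda>((t, x), (u, p, q)). ((0, x), (u, 0, - 2 * q)),
     \<lambda>((t, x), (u, p, q)). ((0, vector [x $ 2, - x $ 1, 0]), (vector [u $ 2, - u $ 1, 0], 0, 0)),
     \<lambda>((t, x), (u, p, q)). ((0, vector [0, - x $ 3, x $ 2]), (vector [0, - u $ 3, u $ 2], 0, 0)),
     \<lambda>((t, x), (u, p, q)). ((0, vector [- x $ 3, 0, x $ 1]), (vector [- u $ 3, 0, u $ 1], 0, 0)),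
     \<lambda>((t, x), (u, p, q)). ((0, 0), (0, p, q))]"

definition euler_fields_span :: "(phase \<Rightarrow> phase) set" where
  "euler_fields_span = range (\<lambda>a m. \<Sum>i<13. (a i :: real) *\<^sub>R (euler_fields ! i) m)"


definition galilean_matrix :: "real \<Rightarrow> real^3 \<Rightarrow> real^3^3 \<Rightarrow> real^3 \<Rightarrow> real^5^5" where
  "galilean_matrix s v R y = vector
     [vector [1,     0,         0,         0,         s],
      vector [v $ 1, R $ 1 $ 1, R $ 1 $ 2, R $ 1 $ 3, y $ 1],
      vector [v $ 2, R $ 2 $ 1, R $ 2 $ 2, R $ 2 $ 3, y $ 2],
      vector [v $ 3, R $ 3 $ 1, R $ 3 $ 2, R $ 3 $ 3, y $ 3],
      vector [0,     0,         0,         0,         1]]"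

definition galilean_group :: "(real^5^5) monoid" where
  "galilean_group =
     \<lparr>carrier = {galilean_matrix s v R y | s v R y. orthogonal_matrix R}, mult = (**), one = mat 1\<rparr>"

text \<open>The Galilean group acts on space-time through the affine embedding \<open>(t, x) \<mapsto> (t, x, 1)\<close>.\<close>

definition homogeneous :: "spacetime \<Rightarrow> real^5" where
  "homogeneous = (\<lambda>(t, x). vector [t, x $ 1, x $ 2, x $ 3, 1])"

end

theory Submission
  imports Defs
begin

text \<open>By hypothesis, one-parameter groups of symmetries are flows of affine fields, hence consist of
  similitudes: Galilean transformations combined with positive scalings. Since conjugation by a
  symmetry \<open>\<phi>\<close> preserves one-parameter groups, it maps flows to similitudes.
  Boosts, translations and time translations are contracted to the identity by scalings; their
  \<open>\<phi>\<close>-conjugates then have no scaling part and, as the trace is a class function, no rotation part.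
  Half turns are involutions, so their conjugates have no scaling part either, and because half
  turns invert boosts and translations, conjugation preserves the group of boosts and translations.
  Parity \<open>x \<mapsto> - x\<close>, \<open>u \<mapsto> - u\<close> lies outside the identity component. Its conjugate inverts boosts and
  translations and commutes, up to these, with time translations, scalings and half turns; this
  determines it up to factors on \<open>p\<close> and \<open>q\<close>, which are 1 by invariance of dimension applied to
  the fixed points. As half turns and parity generate the orthogonal group, normality follows.\<close>

section \<open>Smooth maps\<close>

text \<open>The hypothesis describes only the one-parameter groups of symmetries. A symmetry \<phi>
  lying on no flow may be far from affine, and its only known link with the fields is that
  conjugation by it permutes flows. Every argument therefore reads the parameters of a conjugate off
  a group relation (a commutation, an involution, a contraction) that conjugation transports. The
  obstruction to normality is the positive scalings, since the hypothesis makes conjugates of flows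
  similitudes but does not make them Galilean. The scaling factors commute, so a relation between
  conjugates becomes an equation between positive numbers. Half turns are preferred to general
  rotations because finite order leaves no room for such a factor, and because one half turn can
  invert two given vectors at once. The conjugate of parity is not known to be a similitude at all.
  It has to be reconstructed as a map, and its being an involution would still permit the factors -1
  on pressure and density; counting dimensions of fixed points excludes this.\<close>

lemma Ck_on_cong:
  assumes "open W" "\<And>x. x \<in> W \<Longrightarrow> f x = g x" "Ck_on k W f"
  shows "Ck_on k W g"
  using assms(2,3)
proof (induction k arbitrary: f g)
  case 0
  then show ?case using continuous_on_cong by force
next
  case (Suc k)
  have fd: "(f has_derivative frechet_derivative f (at x)) (at x)" if "x \<in> W" for x
    using Suc.prems that frechet_derivative_works by auto
  have gd: "(g has_derivative frechet_derivative f (at x)) (at x)" if "x \<in> W" for x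
    using has_derivative_transform_within_open[OF fd[OF that] \<open>open W\<close> that] Suc.prems(1) by auto
  have "frechet_derivative g (at x) = frechet_derivative f (at x)" if "x \<in> W" for x
    using frechet_derivative_at[OF gd[OF that]] by simp
  then have "Ck_on k W (\<lambda>x. frechet_derivative g (at x) d)" for d
    using Suc.IH[of "\<lambda>x. frechet_derivative f (at x) d"] Suc.prems by auto
  with gd show ?case by (auto simp: differentiable_def)
qed

lemma Ck_on_subset: "Ck_on k W f \<Longrightarrow> V \<subseteq> W \<Longrightarrow> Ck_on k V f"
  by (induction k arbitrary: f) (auto intro: continuous_on_subset)

lemma Ck_on_local:
  assumes "\<And>x. x \<in> W \<Longrightarrow> \<exists>V. open V \<and> x \<in> V \<and> Ck_on k V f"
  shows "Ck_on k W f"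
  using assms
proof (induction k arbitrary: f)
  case 0
  have "isCont f x" if "x \<in> W" for x
    using 0[OF that] by (auto simp: continuous_on_eq_continuous_at)
  then show ?case by (simp add: continuous_at_imp_continuous_on)
next
  case (Suc k)
  have "\<exists>V. open V \<and> x \<in> V \<and> Ck_on k V (\<lambda>x. frechet_derivative f (at x) d)"
    if "x \<in> W" for x d
    using Suc.prems[OF that] by auto
  then have "Ck_on k W (\<lambda>x. frechet_derivative f (at x) d)" for d
    by (rule Suc.IH)
  moreover have "f differentiable (at x)" if "x \<in> W" for x
    using Suc.prems[OF that] by auto
  ultimately show ?case by simp
qed

lemma Ck_on_Suc_imp: "Ck_on (Suc k) W f \<Longrightarrow> Ck_on k W f"
proof (induction k arbitrary: f)
  case 0
  then show ?case
    by (auto intro!: continuous_at_imp_continuous_on differentiable_imp_continuous_within)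
next
  case (Suc k)
  then show ?case by (meson Ck_on.simps(2))
qed

lemma Ck_on_const: "Ck_on k W (\<lambda>x. c)"
  by (induction k arbitrary: c) auto

lemma Ck_on_linear_compose:
  assumes "open W" "bounded_linear L" "Ck_on k W f"
  shows "Ck_on k W (\<lambda>x. L (f x))"
  using assms(3)
proof (induction k arbitrary: f)
  case 0
  then show ?case by (simp add: assms(2) bounded_linear.continuous_on)
next
  case (Suc k)
  have d: "((\<lambda>x. L (f x)) has_derivative (\<lambda>d. L (frechet_derivative f (at x) d))) (at x)"
    if "x \<in> W" for x
    using Suc.prems that
    by (intro bounded_linear.has_derivative[OF assms(2)]) (auto simp: frechet_derivative_works[symmetric])
  have "frechet_derivative (\<lambda>x. L (f x)) (at x) = (\<lambda>d. L (frechet_derivative f (at x) d))"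
    if "x \<in> W" for x
    using frechet_derivative_at[OF d[OF that]] by simp
  then have "Ck_on k W (\<lambda>x. frechet_derivative (\<lambda>x. L (f x)) (at x) d)" for d
    using Suc.prems
    by - (rule Ck_on_cong[OF assms(1) _ Suc.IH[of "\<lambda>x. frechet_derivative f (at x) d"]], simp_all)
  with d show ?case by (auto simp: differentiable_def)
qed

lemma Ck_on_add:
  assumes "open W" "Ck_on k W f" "Ck_on k W g"
  shows "Ck_on k W (\<lambda>x. f x + g x)"
  using assms(2,3)
proof (induction k arbitrary: f g)
  case 0
  then show ?case by (simp add: continuous_on_add)
next
  case (Suc k)
  have d: "((\<lambda>x. f x + g x) has_derivative
      (\<lambda>d. frechet_derivative f (at x) d + frechet_derivative g (at x) d)) (at x)"
    if "x \<in> W" for x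
    using Suc.prems that
    by (intro has_derivative_add) (auto simp: frechet_derivative_works[symmetric])
  have "frechet_derivative (\<lambda>x. f x + g x) (at x)
      = (\<lambda>d. frechet_derivative f (at x) d + frechet_derivative g (at x) d)"
    if "x \<in> W" for x
    using frechet_derivative_at[OF d[OF that]] by simp
  then have "Ck_on k W (\<lambda>x. frechet_derivative (\<lambda>x. f x + g x) (at x) d)" for d
    using Suc.prems
    by - (rule Ck_on_cong[OF assms(1) _ Suc.IH[of "\<lambda>x. frechet_derivative f (at x) d"
          "\<lambda>x. frechet_derivative g (at x) d"]], simp_all)
  with d show ?case by (auto simp: differentiable_def)
qed

lemma Ck_on_sum:
  assumes "open W" "\<And>i. i \<in> I \<Longrightarrow> Ck_on k W (f i)"
  shows "Ck_on k W (\<lambda>x. \<Sum>i\<in>I. f i x)"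
  using assms(2)
  by (induction I rule: infinite_finite_induct) (simp_all add: Ck_on_const Ck_on_add[OF assms(1)])

text \<open>The Leibniz rule produces terms of the same shape with one argument differentiated, so
  the induction runs over both \<open>f\<close> and \<open>g\<close>; the undifferentiated argument
  gives up one order through \<open>Ck_on_Suc_imp\<close>.\<close>

lemma Ck_on_bilinear:
  assumes "open W" "bounded_bilinear B" "Ck_on k W f" "Ck_on k W g"
  shows "Ck_on k W (\<lambda>x. B (f x) (g x))"
  using assms(3,4)
proof (induction k arbitrary: f g)
  case 0
  then show ?case by (simp add: bounded_bilinear.continuous_on[OF assms(2)])
next
  case (Suc k)
  have d: "((\<lambda>x. B (f x) (g x)) has_derivative
      (\<lambda>d. B (f x) (frechet_derivative g (at x) d) + B (frechet_derivative f (at x) d) (g x))) (at x)"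
    if "x \<in> W" for x
    using Suc.prems that
    by (intro bounded_bilinear.FDERIV[OF assms(2)]) (auto simp: frechet_derivative_works[symmetric])
  have e: "frechet_derivative (\<lambda>x. B (f x) (g x)) (at x)
      = (\<lambda>d. B (f x) (frechet_derivative g (at x) d) + B (frechet_derivative f (at x) d) (g x))"
    if "x \<in> W" for x
    using frechet_derivative_at[OF d[OF that]] by simp
  have "Ck_on k W (\<lambda>x. frechet_derivative (\<lambda>x. B (f x) (g x)) (at x) d)" for d
  proof (rule Ck_on_cong[OF assms(1)])
    show "Ck_on k W (\<lambda>x. B (f x) (frechet_derivative g (at x) d)
        + B (frechet_derivative f (at x) d) (g x))"
      using Suc.prems Ck_on_Suc_imp[OF Suc.prems(1)] Ck_on_Suc_imp[OF Suc.prems(2)]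
      by (intro Ck_on_add[OF assms(1)] Suc.IH) simp_all
  qed (simp add: e)
  with d show ?case by (auto simp: differentiable_def)
qed

text \<open>The chain rule applies the derivative of \<open>g\<close> to a direction that varies
  with \<open>x\<close>, whereas \<open>Ck_on\<close> speaks of derivatives in a fixed direction.
  Expanding that direction in \<open>Basis\<close> gives scalar coefficients times derivatives of
  \<open>g\<close> in fixed directions. The induction hypothesis covers the latter, hence
  \<open>g\<close> is generalized while \<open>f\<close> stays the same.\<close>

lemma Ck_on_compose:
  fixes f :: "'a::euclidean_space \<Rightarrow> 'b::euclidean_space" and g :: "'b \<Rightarrow> 'c::real_normed_vector"
  assumes "open W" "f ` W \<subseteq> V" "Ck_on k V g" "Ck_on k W f"
  shows "Ck_on k W (\<lambda>x. g (f x))"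
  using assms(3,4)
proof (induction k arbitrary: g)
  case 0
  then show ?case using assms(2) continuous_on_compose2 by auto
next
  case (Suc k)
  have d: "((\<lambda>x. g (f x)) has_derivative
      (\<lambda>d. frechet_derivative g (at (f x)) (frechet_derivative f (at x) d))) (at x)"
    if "x \<in> W" for x
    using Suc.prems that assms(2)
    by (intro diff_chain_at[of f _ x g, unfolded o_def]) (auto simp: frechet_derivative_works[symmetric])
  have e: "frechet_derivative (\<lambda>x. g (f x)) (at x) d
      = (\<Sum>b\<in>Basis. (frechet_derivative f (at x) d \<bullet> b) *\<^sub>R frechet_derivative g (at (f x)) b)"
    if "x \<in> W" for x d
  proof -
    have lin: "linear (frechet_derivative g (at (f x)))"
      using Suc.prems that assms(2) by (intro linear_frechet_derivative) auto
    have "frechet_derivative g (at (f x)) (frechet_derivative f (at x) d)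
      = frechet_derivative g (at (f x)) (\<Sum>b\<in>Basis. (frechet_derivative f (at x) d \<bullet> b) *\<^sub>R b)"
      by (simp add: euclidean_representation)
    also have "\<dots>
      = (\<Sum>b\<in>Basis. (frechet_derivative f (at x) d \<bullet> b) *\<^sub>R frechet_derivative g (at (f x)) b)"
      by (simp add: linear_sum[OF lin] linear_cmul[OF lin])
    finally show ?thesis using frechet_derivative_at[OF d[OF that]] by metis
  qed
  have "Ck_on k W (\<lambda>x. frechet_derivative (\<lambda>x. g (f x)) (at x) d)" for d
  proof (rule Ck_on_cong[OF assms(1)])
    have "Ck_on k W (\<lambda>x. frechet_derivative g (at (f x)) b)" for b
      using Suc.prems Ck_on_Suc_imp[OF Suc.prems(2)] by - (rule Suc.IH, simp_all)
    moreover have "Ck_on k W (\<lambda>x. frechet_derivative f (at x) d \<bullet> b)" for b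
      using Suc.prems
      by - (rule Ck_on_linear_compose[OF assms(1) bounded_linear_inner_left], simp)
    ultimately
    show "Ck_on k W (\<lambda>x. \<Sum>b\<in>Basis. (frechet_derivative f (at x) d \<bullet> b) *\<^sub>R
        frechet_derivative g (at (f x)) b)"
      by (intro Ck_on_sum[OF assms(1)] Ck_on_bilinear[OF assms(1) bounded_bilinear_scaleR]) blast+
  qed (simp add: e)
  with d show ?case by (auto simp: differentiable_def)
qed

text \<open>Over an open set the local extensions restrict to \<open>f\<close> itself, so smoothness
  becomes \<open>Ck_on\<close> for every order and inherits its closure rules.\<close>

lemma smooth_on_open_iff:
  assumes "open S"
  shows "smooth_on S f \<longleftrightarrow> (\<forall>k. Ck_on k S f)"
proof
  assume s: "smooth_on S f"
  show "\<forall>k. Ck_on k S f"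
  proof (intro allI Ck_on_local)
    fix k x assume "x \<in> S"
    with s obtain W g where W: "open W" "x \<in> W" "\<And>k. Ck_on k W g" "\<And>y. y \<in> S \<inter> W \<Longrightarrow> g y = f y"
      unfolding smooth_on_def by metis
    have "Ck_on k (S \<inter> W) f"
      using W assms by - (rule Ck_on_cong[of "S \<inter> W" g f], auto intro: Ck_on_subset)
    then show "\<exists>V. open V \<and> x \<in> V \<and> Ck_on k V f"
      using W assms \<open>x \<in> S\<close> by (intro exI[of _ "S \<inter> W"]) auto
  qed
next
  assume "\<forall>k. Ck_on k S f"
  then show "smooth_on S f"
    unfolding smooth_on_def using assms by blast
qed

lemma smooth_on_subset: "smooth_on S f \<Longrightarrow> T \<subseteq> S \<Longrightarrow> smooth_on T f"
  unfolding smooth_on_def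
proof (intro ballI)
  fix x assume *: "\<forall>x\<in>S. \<exists>W g. open W \<and> x \<in> W \<and> (\<forall>k. Ck_on k W g) \<and> (\<forall>y\<in>S \<inter> W. g y = f y)"
    "T \<subseteq> S" "x \<in> T"
  then have "x \<in> S" by auto
  with *(1) obtain W g where "open W" "x \<in> W" "\<forall>k. Ck_on k W g" "\<forall>y\<in>S \<inter> W. g y = f y"
    by meson
  with *(2) show "\<exists>W g. open W \<and> x \<in> W \<and> (\<forall>k. Ck_on k W g) \<and> (\<forall>y\<in>T \<inter> W. g y = f y)"
    by (intro exI[of _ W] exI[of _ g]) auto
qed

lemma smooth_on_differentiable:
  assumes "open S" "smooth_on S f" "x \<in> S"
  shows "f differentiable (at x)"
proof -
  have "Ck_on (Suc 0) S f"
    using assms smooth_on_open_iff by blast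
  then show ?thesis using assms(3) by simp
qed

lemma smooth_on_compose:
  fixes f :: "'a::euclidean_space \<Rightarrow> 'b::euclidean_space"
  assumes "open W" "open V" "smooth_on V g" "smooth_on W f" "f ` W \<subseteq> V"
  shows "smooth_on W (\<lambda>x. g (f x))"
  using assms(3,4) Ck_on_compose[OF assms(1,5)] assms(1,2) by (auto simp: smooth_on_open_iff)

lemma smooth_on_linear_compose:
  assumes "open W" "bounded_linear L" "smooth_on W f"
  shows "smooth_on W (\<lambda>x. L (f x))"
  using assms Ck_on_linear_compose[OF assms(1,2)] by (auto simp: smooth_on_open_iff[OF assms(1)])

lemma smooth_on_bilinear:
  assumes "open W" "bounded_bilinear B" "smooth_on W f" "smooth_on W g"
  shows "smooth_on W (\<lambda>x. B (f x) (g x))"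
  using assms Ck_on_bilinear[OF assms(1,2)] by (auto simp: smooth_on_open_iff[OF assms(1)])

lemma smooth_on_add:
  assumes "open W" "smooth_on W f" "smooth_on W g"
  shows "smooth_on W (\<lambda>x. f x + g x)"
  using assms(2,3) unfolding smooth_on_open_iff[OF assms(1)]
  by (intro allI Ck_on_add[OF assms(1)]) auto

lemma smooth_on_const: "open W \<Longrightarrow> smooth_on W (\<lambda>x. c)"
  by (simp add: smooth_on_open_iff Ck_on_const)

lemma bounded_linear_smooth_on:
  fixes L :: "'a::euclidean_space \<Rightarrow> 'b::real_normed_vector"
  assumes "open W" "bounded_linear L"
  shows "smooth_on W L"
proof -
  have "frechet_derivative L (at x) = L" for x
    using frechet_derivative_at[OF bounded_linear_imp_has_derivative[OF assms(2)]] by metis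
  then have "Ck_on k W L" for k
    using assms(2) linear_continuous_on bounded_linear_imp_differentiable
    by (cases k) (auto simp: Ck_on_const)
  then show ?thesis by (simp add: assms(1) smooth_on_open_iff)
qed

lemma smooth_on_Pair:
  assumes "open W" "smooth_on W f" "smooth_on W g"
  shows "smooth_on W (\<lambda>x. (f x, g x))"
proof -
  have "smooth_on W (\<lambda>x. (f x, 0) + (0, g x))"
    using assms
    by (intro smooth_on_add smooth_on_linear_compose[where L = "\<lambda>a. (a, 0)" and f = f]
        smooth_on_linear_compose[where L = "\<lambda>a. (0, a)" and f = g]
        bounded_linear_Pair bounded_linear_zero bounded_linear_ident)
  then show ?thesis by simp
qed

lemma smooth_on_euclidean:
  fixes f :: "'a::euclidean_space \<Rightarrow> 'b::euclidean_space"
  assumes "open W" "\<And>b. b \<in> Basis \<Longrightarrow> smooth_on W (\<lambda>x. f x \<bullet> b)"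
  shows "smooth_on W f"
proof -
  have "Ck_on k W (\<lambda>x. \<Sum>b\<in>Basis. (f x \<bullet> b) *\<^sub>R b)" for k
    using assms
    by (intro Ck_on_sum Ck_on_linear_compose[OF _ bounded_linear_scaleR_left, where f = "\<lambda>x. f x \<bullet> _"])
      (auto simp: smooth_on_open_iff)
  then show ?thesis by (simp add: assms(1) smooth_on_open_iff euclidean_representation)
qed

lemma smooth_on_vec:
  fixes f :: "'a::euclidean_space \<Rightarrow> 'b::euclidean_space^'n"
  assumes "open W" "\<And>i. smooth_on W (\<lambda>x. f x $ i)"
  shows "smooth_on W f"
proof (rule smooth_on_euclidean[OF assms(1)])
  fix b :: "'b^'n" assume "b \<in> Basis"
  then obtain i c where b: "b = axis i c" by (auto simp: Basis_vec_def)
  show "smooth_on W (\<lambda>x. f x \<bullet> b)"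
    unfolding b inner_axis
    by (rule smooth_on_linear_compose[OF assms(1) bounded_linear_inner_left assms(2)])
qed

section \<open>The symmetry group\<close>

abbreviation inverse_map :: "('a \<Rightarrow> 'a) \<Rightarrow> 'a \<Rightarrow> 'a" where
  "inverse_map \<equiv> inv_into UNIV"

lemma diffeomorphism_smooth:
  "diffeomorphism \<phi> \<Longrightarrow> smooth_on UNIV \<phi>" "diffeomorphism \<phi> \<Longrightarrow> smooth_on UNIV (inverse_map \<phi>)"
  "diffeomorphism \<phi> \<Longrightarrow> bij \<phi>"
  by (simp_all add: diffeomorphism_def)

lemma diffeomorphism_comp:
  assumes "diffeomorphism \<phi>" "diffeomorphism \<psi>"
  shows "diffeomorphism (\<phi> \<circ> \<psi>)"
proof -
  have "inverse_map (\<phi> \<circ> \<psi>) = inverse_map \<psi> \<circ> inverse_map \<phi>"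
    using assms by (simp add: diffeomorphism_def o_inv_distrib)
  moreover have "smooth_on UNIV (\<phi> \<circ> \<psi>)" unfolding comp_def
    by (rule smooth_on_compose[of UNIV UNIV]) (use assms diffeomorphism_smooth in auto)
  moreover have "smooth_on UNIV (inverse_map \<psi> \<circ> inverse_map \<phi>)" unfolding comp_def
    by (rule smooth_on_compose[of UNIV UNIV]) (use assms diffeomorphism_smooth in auto)
  ultimately show ?thesis
    using assms by (simp add: diffeomorphism_def bij_comp)
qed

lemma diffeomorphism_inverse:
  "diffeomorphism \<phi> \<Longrightarrow> diffeomorphism (inverse_map \<phi>)"
  by (simp add: diffeomorphism_def bij_imp_bij_inv inv_inv_eq)

lemma symmetry_group_simps [simp]:
  "mult (symmetry_group \<gamma>) = (\<circ>)" "one (symmetry_group \<gamma>) = id"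
  by (simp_all add: symmetry_group_def)

lemma symmetry_group_diffeomorphism: "\<phi> \<in> carrier (symmetry_group \<gamma>) \<Longrightarrow> diffeomorphism \<phi>"
  by (simp add: symmetry_group_def)

lemma symmetry_group_bij: "\<phi> \<in> carrier (symmetry_group \<gamma>) \<Longrightarrow> bij \<phi>"
  by (simp add: symmetry_group_def diffeomorphism_def)

lemma symmetry_group_comp:
  assumes "\<phi> \<in> carrier (symmetry_group \<gamma>)" "\<psi> \<in> carrier (symmetry_group \<gamma>)"
  shows "\<phi> \<circ> \<psi> \<in> carrier (symmetry_group \<gamma>)"
proof -
  have "(\<phi> \<circ> \<psi>) ` S \<in> solution_graphs \<gamma> \<longleftrightarrow> S \<in> solution_graphs \<gamma>" for S
    using assms unfolding image_comp[symmetric] by (simp add: symmetry_group_def)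
  moreover have "diffeomorphism (\<phi> \<circ> \<psi>)"
    using assms by (intro diffeomorphism_comp symmetry_group_diffeomorphism)
  ultimately show ?thesis by (simp add: symmetry_group_def)
qed

lemma symmetry_group_inverse:
  assumes "\<phi> \<in> carrier (symmetry_group \<gamma>)"
  shows "inverse_map \<phi> \<in> carrier (symmetry_group \<gamma>)"
proof -
  have "bij \<phi>" using assms by (rule symmetry_group_bij)
  then have "\<phi> ` inverse_map \<phi> ` S = S" for S
    by (simp add: bij_is_surj image_f_inv_f)
  then show ?thesis
    using assms by (auto simp: symmetry_group_def diffeomorphism_inverse)
       metis+
qed

lemma inverse_map_comp:
  "bij \<phi> \<Longrightarrow> inverse_map \<phi> \<circ> \<phi> = id" "bij \<phi> \<Longrightarrow> \<phi> \<circ> inverse_map \<phi> = id"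
  "bij \<phi> \<Longrightarrow> inverse_map \<phi> (\<phi> m) = m" "bij \<phi> \<Longrightarrow> \<phi> (inverse_map \<phi> m) = m"
  by (auto simp: bij_def surj_iff surj_f_inv_f)

lemma id_diffeomorphism: "diffeomorphism id"
  using bounded_linear_smooth_on[OF open_UNIV bounded_linear_ident]
  by (simp add: diffeomorphism_def id_def[symmetric] inv_id)

lemma symmetry_group_group: "group (symmetry_group \<gamma>)"
proof (rule groupI)
  show "\<exists>y\<in>carrier (symmetry_group \<gamma>). y \<otimes>\<^bsub>symmetry_group \<gamma>\<^esub> x = \<one>\<^bsub>symmetry_group \<gamma>\<^esub>"
    if "x \<in> carrier (symmetry_group \<gamma>)" for x
    using that symmetry_group_inverse symmetry_group_bij inverse_map_comp(1)
    by (metis symmetry_group_simps)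
  show "\<one>\<^bsub>symmetry_group \<gamma>\<^esub> \<in> carrier (symmetry_group \<gamma>)"
    by (simp add: symmetry_group_def id_diffeomorphism)
qed (auto intro: symmetry_group_comp[unfolded o_def] simp: o_def)

lemma symmetry_group_m_inv:
  assumes "\<phi> \<in> carrier (symmetry_group \<gamma>)"
  shows "m_inv (symmetry_group \<gamma>) \<phi> = inverse_map \<phi>"
  using assms symmetry_group_bij inverse_map_comp(1)
  by (intro group.inv_equality[OF symmetry_group_group] symmetry_group_inverse) auto

section \<open>One-parameter groups of symmetries\<close>

definition one_parameter_group where
  "one_parameter_group \<gamma> c X \<longleftrightarrow> smooth_curve c \<and> (\<forall>s. c s \<in> carrier (symmetry_group \<gamma>)) \<and>
     (\<forall>r s. c (r + s) = c r \<circ> c s) \<and> (\<forall>m. ((\<lambda>s. c s m) has_vector_derivative X m) (at 0))"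

lemma lie_algebra_one_parameter_group:
  "X \<in> lie_algebra (symmetry_group \<gamma>) \<longleftrightarrow> (\<exists>c. one_parameter_group \<gamma> c X)"
  by (simp add: lie_algebra_def one_parameter_group_def)

text \<open>An injective idempotent map is the identity.\<close>

lemma one_parameter_group_0:
  assumes "one_parameter_group \<gamma> c X"
  shows "c 0 = id"
proof -
  have *: "c (0 + 0) = c 0 \<circ> c 0" "bij (c 0)"
    using assms symmetry_group_bij by (auto simp only: one_parameter_group_def)
  have "c 0 (c 0 m) = c 0 m" for m
    using fun_cong[OF *(1), of m] by (simp only: add_0 comp_apply)
  then show ?thesis
    using bij_is_inj[OF *(2)] unfolding fun_eq_iff id_apply by (blast dest: injD)
qed

text \<open>Writing \<open>c r\<close> as \<open>c (r - s) \<circ> c s\<close> moves the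
  differentiation at \<open>s\<close> to one at 0.\<close>

lemma one_parameter_group_ode:
  assumes "one_parameter_group \<gamma> c X"
  shows "((\<lambda>s. c s m) has_vector_derivative X (c s m)) (at s)"
proof -
  have "((\<lambda>r. c r (c s m)) has_vector_derivative X (c s m)) (at 0)"
    using assms unfolding one_parameter_group_def by blast
  then have "((\<lambda>r. c r (c s m)) has_vector_derivative X (c s m)) (at (s - s))"
    by simp
  moreover have "((\<lambda>r. r - s) has_vector_derivative 1) (at s)"
    by (auto intro!: derivative_eq_intros)
  ultimately have "((\<lambda>r. c r (c s m)) \<circ> (\<lambda>r. r - s) has_vector_derivative 1 *\<^sub>R X (c s m)) (at s)"
    by (intro vector_diff_chain_at)
  moreover have "((\<lambda>r. c r (c s m)) \<circ> (\<lambda>r. r - s)) r = c r m" for r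
  proof -
    have "c (r - s + s) = c (r - s) \<circ> c s"
      using assms by (simp only: one_parameter_group_def)
    then show ?thesis by simp
  qed
  ultimately show ?thesis by (simp add: fun_eq_iff[symmetric] o_def)
qed

text \<open>The generator of the conjugated group is the push-forward of \<open>X\<close> by \<phi>.
  The statement keeps only its existence: the form of \<open>Y\<close> will come from the hypothesis
  on the Lie algebra.\<close>

lemma one_parameter_group_conj:
  assumes "one_parameter_group \<gamma> c X" and \<phi>: "\<phi> \<in> carrier (symmetry_group \<gamma>)"
  shows "\<exists>Y. one_parameter_group \<gamma> (\<lambda>s. \<phi> \<circ> c s \<circ> inverse_map \<phi>) Y"
proof -
  let ?d = "\<lambda>s. \<phi> \<circ> c s \<circ> inverse_map \<phi>"
  have c: "smooth_on UNIV (\<lambda>(s, m). c s m)" "\<And>s. c s \<in> carrier (symmetry_group \<gamma>)"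
      "\<And>r s. c (r + s) = c r \<circ> c s" "\<And>m. ((\<lambda>s. c s m) has_vector_derivative X m) (at 0)"
    using assms(1) by (auto simp: one_parameter_group_def smooth_curve_def)
  have sm: "smooth_on UNIV \<phi>" "smooth_on UNIV (inverse_map \<phi>)" "bij \<phi>"
    using diffeomorphism_smooth symmetry_group_diffeomorphism[OF \<phi>] by auto
  have "smooth_on UNIV (\<lambda>z. inverse_map \<phi> (snd z))" for z :: "real \<times> phase"
    by (rule smooth_on_compose[of UNIV UNIV])
      (use sm bounded_linear_smooth_on[OF open_UNIV bounded_linear_snd] in auto)
  moreover have "smooth_on UNIV (fst :: real \<times> phase \<Rightarrow> real)"
    by (intro bounded_linear_smooth_on open_UNIV bounded_linear_fst)
  ultimately have "smooth_on UNIV (\<lambda>z :: real \<times> phase. (fst z, inverse_map \<phi> (snd z)))"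
    by (intro smooth_on_Pair open_UNIV)
  then have "smooth_on UNIV (\<lambda>z :: real \<times> phase. (\<lambda>(s, m). c s m) (fst z, inverse_map \<phi> (snd z)))"
    by (rule smooth_on_compose[of UNIV UNIV, rotated 3]) (use c in auto)
  then have "smooth_on UNIV (\<lambda>z :: real \<times> phase. \<phi> ((\<lambda>(s, m). c s m) (fst z, inverse_map \<phi> (snd z))))"
    by (rule smooth_on_compose[of UNIV UNIV, rotated 3]) (use sm in auto)
  then have "smooth_curve ?d"
    by (simp add: smooth_curve_def case_prod_unfold)
  moreover have "?d s \<in> carrier (symmetry_group \<gamma>)" for s
    by (intro symmetry_group_comp symmetry_group_inverse c \<phi>)
  moreover have "?d (r + s) = ?d r \<circ> ?d s" for r s
    using inverse_map_comp(3)[OF sm(3)] by (auto simp: c(3) o_def)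
  moreover have "((\<lambda>s. ?d s m) has_vector_derivative
      frechet_derivative \<phi> (at (inverse_map \<phi> m)) (X (inverse_map \<phi> m))) (at 0)" for m
  proof -
    let ?m = "inverse_map \<phi> m"
    have "((\<lambda>s. c s ?m) has_derivative (\<lambda>h. h *\<^sub>R X ?m)) (at 0)"
      using c(4) by (simp add: has_vector_derivative_def)
    moreover have 0: "c 0 ?m = ?m"
      using one_parameter_group_0[OF assms(1)] by simp
    moreover have \<phi>': "\<phi> differentiable (at ?m)"
      using smooth_on_differentiable[OF open_UNIV sm(1)] by simp
    ultimately have "((\<lambda>s. \<phi> (c s ?m)) has_derivative
        (\<lambda>h. frechet_derivative \<phi> (at ?m) (h *\<^sub>R X ?m))) (at 0)"
      by (intro diff_chain_at[of "\<lambda>s. c s ?m" _ 0 \<phi>, unfolded o_def])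
        (auto simp: frechet_derivative_works)
    then show ?thesis
      using linear_cmul[OF linear_frechet_derivative[OF \<phi>']]
      by (simp add: has_vector_derivative_def)
  qed
  ultimately show ?thesis
    unfolding one_parameter_group_def
    by (intro exI[of _ "\<lambda>m. frechet_derivative \<phi> (at (inverse_map \<phi> m)) (X (inverse_map \<phi> m))"]
        conjI allI)
qed

section \<open>Parity as a symmetry, checked on the equations\<close>

definition parity :: "phase \<Rightarrow> phase" where
  "parity = (\<lambda>((t, x), (u, p, q)). ((t, - x), (- u, p, q)))"

definition space_parity :: "spacetime \<Rightarrow> spacetime" where
  "space_parity = (\<lambda>(t, x). (t, - x))"

lemma parity_parity [simp]: "parity (parity m) = m"
  by (cases m) (auto simp: parity_def)

lemma space_parity_space_parity [simp]: "space_parity (space_parity e) = e"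
  by (cases e) (auto simp: space_parity_def)

lemma bounded_linear_space_parity: "bounded_linear space_parity"
  by (intro linear_conv_bounded_linear[THEN iffD1] linearI) (auto simp: space_parity_def)

lemma bounded_linear_parity: "bounded_linear parity"
  by (intro linear_conv_bounded_linear[THEN iffD1] linearI) (auto simp: parity_def)

text \<open>The reflection reverses spatial directions and keeps the time direction. The versions
  with an outer minus serve the velocity components, which change sign themselves.\<close>

lemma frechet_derivative_space_parity:
  fixes g :: "spacetime \<Rightarrow> real"
  assumes "g differentiable (at (space_parity e))"
  shows "D_t (\<lambda>e. g (space_parity e)) e = D_t g (space_parity e)"
    and "D_x j (\<lambda>e. g (space_parity e)) e = - D_x j g (space_parity e)"
    and "D_t (\<lambda>e. - g (space_parity e)) e = - D_t g (space_parity e)"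
    and "D_x j (\<lambda>e. - g (space_parity e)) e = D_x j g (space_parity e)"
proof -
  let ?D = "frechet_derivative g (at (space_parity e))"
  have D: "((\<lambda>e. g (space_parity e)) has_derivative (\<lambda>d. ?D (space_parity d))) (at e)"
    using assms bounded_linear_imp_has_derivative[OF bounded_linear_space_parity]
    by (intro diff_chain_at[of space_parity _ e g, unfolded o_def]) (auto simp: frechet_derivative_works)
  note 1 = frechet_derivative_at[OF D, symmetric]
  note 2 = frechet_derivative_at[OF has_derivative_minus[OF D], symmetric]
  have "linear ?D" using assms by (rule linear_frechet_derivative)
  have v: "space_parity (1, 0) = (1, 0)" "space_parity (0, axis j 1) = (0, - axis j 1)"
    by (simp_all add: space_parity_def)
  have "?D (0, - axis j 1) = - ?D (0, axis j 1)"
    using linear_neg[OF \<open>linear ?D\<close>, of "(0, axis j 1)"] by simp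
  then show "D_t (\<lambda>e. g (space_parity e)) e = D_t g (space_parity e)"
    "D_x j (\<lambda>e. g (space_parity e)) e = - D_x j g (space_parity e)"
    "D_t (\<lambda>e. - g (space_parity e)) e = - D_t g (space_parity e)"
    "D_x j (\<lambda>e. - g (space_parity e)) e = D_x j g (space_parity e)"
    by (simp_all add: D_t_def D_x_def 1 2 v)
qed

text \<open>Velocity and gradient are odd, the time derivative is even. So every term of the
  momentum equations changes sign, while in the other two equations divergence and transport pair
  two odd factors and nothing changes.\<close>

lemma euler_solution_parity:
  assumes "euler_solution \<gamma> U f"
  shows "euler_solution \<gamma> (space_parity ` U) (\<lambda>e. snd (parity (space_parity e, f (space_parity e))))"
proof -
  let ?U = "space_parity ` U" and ?f = "\<lambda>e. snd (parity (space_parity e, f (space_parity e)))"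
  have U: "open U" "smooth_on U f" and eq: "\<And>e. e \<in> U \<Longrightarrow> snd (snd (f e)) \<noteq> 0 \<and>
        euler_equations \<gamma> (\<lambda>e. fst (f e)) (\<lambda>e. fst (snd (f e))) (\<lambda>e. snd (snd (f e))) e"
    using assms by (auto simp: euler_solution_def)
  have img: "?U = space_parity -` U"
    by (auto simp: image_iff) (metis space_parity_space_parity)
  have op: "open ?U"
    unfolding img using U(1) bounded_linear_space_parity
    by (intro open_vimage linear_continuous_on) auto
  have "smooth_on ?U (\<lambda>e. f (space_parity e))"
    by (rule smooth_on_compose[OF op U(1) U(2)
          bounded_linear_smooth_on[OF op bounded_linear_space_parity]]) auto
  \<comment> \<open>The base point of \<open>parity\<close> is set to 0 to obtain a map linear in
    \<open>w\<close>; the state component does not depend on the base point.\<close>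
  then have "smooth_on ?U (\<lambda>e. (\<lambda>w. snd (parity (0, w))) (f (space_parity e)))"
    by (intro smooth_on_linear_compose[OF op, where L = "\<lambda>w. snd (parity (0, w))"]
      bounded_linear_compose[OF bounded_linear_snd] bounded_linear_compose[OF bounded_linear_parity]
      bounded_linear_Pair bounded_linear_zero bounded_linear_ident)
  moreover have "snd (parity (0, w)) = snd (parity (e, w))" for e w
    by (cases e; cases w) (auto simp: parity_def zero_prod_def)
  then have "(\<lambda>e. (\<lambda>w. snd (parity (0, w))) (f (space_parity e))) = ?f"
    by (intro ext)
  ultimately have sm: "smooth_on ?U ?f"
    by simp
  have comp: "fst (?f e) = - fst (f (space_parity e))"
    "fst (snd (?f e)) = fst (snd (f (space_parity e)))"
    "snd (snd (?f e)) = snd (snd (f (space_parity e)))" for e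
    by (auto simp: parity_def case_prod_unfold)
  have "snd (snd (?f e)) \<noteq> 0 \<and> euler_equations \<gamma> (\<lambda>e. fst (?f e)) (\<lambda>e. fst (snd (?f e)))
      (\<lambda>e. snd (snd (?f e))) e" if "e \<in> ?U" for e
  proof -
    have e: "space_parity e \<in> U" using that img by auto
    then have d: "f differentiable (at (space_parity e))"
      using U smooth_on_differentiable by blast
    have L: "(\<lambda>e. L (f e)) differentiable (at (space_parity e))" if "bounded_linear L"
      for L :: "state \<Rightarrow> real"
      using d bounded_linear.has_derivative[OF that] unfolding differentiable_def by blast
    have "(\<lambda>e. fst (f e) $ i) differentiable (at (space_parity e))"
         "(\<lambda>e. fst (snd (f e))) differentiable (at (space_parity e))"
         "(\<lambda>e. snd (snd (f e))) differentiable (at (space_parity e))" for i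
      by (intro L bounded_linear_compose[OF bounded_linear_vec_nth bounded_linear_fst]
          bounded_linear_compose[OF bounded_linear_fst bounded_linear_snd]
          bounded_linear_compose[OF bounded_linear_snd bounded_linear_snd])+
    note D = this[THEN frechet_derivative_space_parity(1)] this[THEN frechet_derivative_space_parity(2)]
      this[THEN frechet_derivative_space_parity(3)] this[THEN frechet_derivative_space_parity(4)]
    note E = eq[OF e, THEN conjunct2, unfolded euler_equations_def]
    show ?thesis
      unfolding euler_equations_def comp vector_uminus_component D
    proof (intro conjI allI, goal_cases)
      case 1
      then show ?case using eq[OF e] by simp
    next
      case (2 i)
      then show ?case
        using E[THEN conjunct1, THEN spec, of i] by (simp add: sum_negf)
    next
      case 3
      then show ?case
        using E[THEN conjunct2, THEN conjunct1] by (simp add: sum_negf)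
    next
      case 4
      then show ?case
        using E[THEN conjunct2, THEN conjunct2] by (simp add: sum_negf)
    qed
  qed
  with op sm show ?thesis
    by (simp add: euler_solution_def)
qed

lemma parity_solution_graphs:
  assumes "S \<in> solution_graphs \<gamma>"
  shows "parity ` S \<in> solution_graphs \<gamma>"
proof -
  obtain U f where S: "S = (\<lambda>e. (e, f e)) ` U" and "euler_solution \<gamma> U f"
    using assms by (auto simp: solution_graphs_def)
  then have sol: "euler_solution \<gamma> (space_parity ` U) (\<lambda>e. snd (parity (space_parity e, f (space_parity e))))"
    by (intro euler_solution_parity)
  have "parity (e, w) = (space_parity e, snd (parity (e, w)))" for e w
    by (cases e; cases w) (auto simp: parity_def space_parity_def)
  then have img: "parity ` S = (\<lambda>e. (e, snd (parity (space_parity e, f (space_parity e))))) ` space_parity ` U"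
    unfolding S image_image by (intro image_cong) auto
  show ?thesis unfolding img solution_graphs_def
    by (intro CollectI exI[of _ "space_parity ` U"] exI[of _ "\<lambda>e. snd (parity (space_parity e, f (space_parity e)))"]
        conjI refl sol)
qed

text \<open>For an involution, one implication about graphs already yields the equivalence, and
  smoothness covers the inverse.\<close>

lemma parity_symmetry: "parity \<in> carrier (symmetry_group \<gamma>)"
proof -
  have "bij parity" by (rule o_bij[of parity]) auto
  moreover have "inverse_map parity = parity"
    by (rule inv_unique_comp) auto
  ultimately have "diffeomorphism parity"
    using bounded_linear_smooth_on[OF open_UNIV bounded_linear_parity] by (simp add: diffeomorphism_def)
  moreover have "parity ` parity ` S = S" for S by (simp add: image_image)
  ultimately show ?thesis
    using parity_solution_graphs by (auto simp: symmetry_group_def) metis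
qed

section \<open>Flows of the symmetry algebra\<close>

text \<open>The general element of the span in vector form: \<alpha>, \<beta> and \<kappa> are the
  scaling rates of time, of space, and of pressure together with density; \<open>n\<close> is an
  angular velocity, \<open>b\<close> a boost, \<open>y\<close> and \<sigma> are translations.
  Velocity scales like length over time, whence the rate \<open>\<beta> - \<alpha>\<close>.\<close>

definition euler_field ::
  "real \<Rightarrow> real \<Rightarrow> real \<Rightarrow> real \<Rightarrow> real^3 \<Rightarrow> real^3 \<Rightarrow> real^3 \<Rightarrow> phase \<Rightarrow> phase" where
  "euler_field \<alpha> \<sigma> \<beta> \<kappa> n b y = (\<lambda>((t, x), (u, p, q)).
     ((\<alpha> * t + \<sigma>, \<beta> *\<^sub>R x + cross3 n x + t *\<^sub>R b + y),
      ((\<beta> - \<alpha>) *\<^sub>R u + cross3 n u + b, \<kappa> * p, (2 * \<alpha> - 2 * \<beta> + \<kappa>) * q)))"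

text \<open>The list is indexed from 0, so \<open>a 7\<close> belongs to the scaling of time. The
  signs in the angular velocity come from comparison with \<open>cross3\<close>: the first and third
  rotation fields turn negatively about the third and second axes.\<close>

lemma euler_fields_sum:
  "(\<Sum>i<13. a i *\<^sub>R (euler_fields ! i) m) =
   euler_field (a 7) (a 3) (a 8) (a 12) (vector [a 10, - a 11, - a 9])
     (vector [a 4, a 5, a 6]) (vector [a 0, a 1, a 2]) m"
proof -
  obtain t x u p q where m: "m = ((t, x), (u, p, q))" by (metis prod.exhaust)
  have *: "(\<Sum>i<13. a i *\<^sub>R (euler_fields ! i) m) =
    a 0 *\<^sub>R (euler_fields ! 0) m + a 1 *\<^sub>R (euler_fields ! 1) m + a 2 *\<^sub>R (euler_fields ! 2) m
    + a 3 *\<^sub>R (euler_fields ! 3) m + a 4 *\<^sub>R (euler_fields ! 4) m + a 5 *\<^sub>R (euler_fields ! 5) m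
    + a 6 *\<^sub>R (euler_fields ! 6) m + a 7 *\<^sub>R (euler_fields ! 7) m + a 8 *\<^sub>R (euler_fields ! 8) m
    + a 9 *\<^sub>R (euler_fields ! 9) m + a 10 *\<^sub>R (euler_fields ! 10) m
    + a 11 *\<^sub>R (euler_fields ! 11) m + a 12 *\<^sub>R (euler_fields ! 12) m"
    by (simp add: eval_nat_numeral)
  show ?thesis
    unfolding * by (simp add: euler_fields_def euler_field_def m cross3_def vec_eq_iff forall_3 axis_def
        algebra_simps)
qed

lemma euler_fields_span_iff:
  "X \<in> euler_fields_span \<longleftrightarrow> (\<exists>\<alpha> \<sigma> \<beta> \<kappa> n b y. X = euler_field \<alpha> \<sigma> \<beta> \<kappa> n b y)"
proof
  assume "X \<in> euler_fields_span"
  then obtain a where "X = (\<lambda>m. \<Sum>i<13. a i *\<^sub>R (euler_fields ! i) m)"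
    by (auto simp: euler_fields_span_def)
  then show "\<exists>\<alpha> \<sigma> \<beta> \<kappa> n b y. X = euler_field \<alpha> \<sigma> \<beta> \<kappa> n b y"
    unfolding euler_fields_sum by blast
next
  assume "\<exists>\<alpha> \<sigma> \<beta> \<kappa> n b y. X = euler_field \<alpha> \<sigma> \<beta> \<kappa> n b y"
  then obtain \<alpha> \<sigma> \<beta> \<kappa> n b y where X: "X = euler_field \<alpha> \<sigma> \<beta> \<kappa> n b y" by blast
  let ?a = "\<lambda>i. [y$1, y$2, y$3, \<sigma>, b$1, b$2, b$3, \<alpha>, \<beta>, - n$3, n$1, - n$2, \<kappa>] ! i"
  have v: "vector [z$1, z$2, z$3] = z" for z :: "real^3"
    by (simp add: vec_eq_iff forall_3)
  have "(\<lambda>m. \<Sum>i<13. ?a i *\<^sub>R (euler_fields ! i) m) = X"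
    unfolding euler_fields_sum X by (simp add: v)
  then show "X \<in> euler_fields_span"
    unfolding euler_fields_span_def by blast
qed

section \<open>Linear differential equations along the flows\<close>

lemma exponential_ode:
  fixes z :: "real \<Rightarrow> real"
  assumes "\<And>s. (z has_vector_derivative \<kappa> * z s) (at s)"
  shows "z s = exp (\<kappa> * s) * z 0"
proof -
  have "((\<lambda>s. exp (- \<kappa> * s) * z s) has_real_derivative 0) (at s)" for s
    using assms[of s, unfolded has_real_derivative_iff_has_vector_derivative[symmetric]]
    by (auto intro!: derivative_eq_intros)
  then have "exp (- \<kappa> * s) * z s = exp (- \<kappa> * 0) * z 0"
    by (intro DERIV_isconst_all) auto
  then show ?thesis by (simp add: exp_minus field_simps)
qed

text \<open>The \<open>cross3\<close> term is orthogonal to \<open>z s\<close>, so the squared norm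
  satisfies a scalar exponential equation. This gives uniqueness and isometry without solving for
  the rotation.\<close>

lemma skew_ode_norm:
  fixes z :: "real \<Rightarrow> real^3"
  assumes "\<And>s. (z has_vector_derivative \<kappa> *\<^sub>R z s + cross3 n (z s)) (at s)"
  shows "norm (z s) = exp (\<kappa> * s) * norm (z 0)"
proof -
  have "((\<lambda>s. z s \<bullet> z s) has_vector_derivative (2 * \<kappa>) * (z s \<bullet> z s)) (at s)" for s
    using bounded_bilinear.has_vector_derivative[OF bounded_bilinear_inner assms[of s] assms[of s]]
    by (simp add: inner_add_left inner_add_right dot_cross_self algebra_simps)
  from exponential_ode[OF this, of s]
  have "(norm (z s))\<^sup>2 = (exp (\<kappa> * s) * norm (z 0))\<^sup>2"
    by (simp add: power2_norm_eq_inner power_mult_distrib exp_double[symmetric] mult.assoc)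
  then show ?thesis
    by (simp add: power2_eq_iff_nonneg)
qed

lemma euler_field_components:
  assumes "(c has_vector_derivative euler_field \<alpha> \<sigma> \<beta> \<kappa> n b y (c s)) (at s)"
  shows "((\<lambda>s. fst (fst (c s))) has_vector_derivative \<alpha> * fst (fst (c s)) + \<sigma>) (at s)"
    and "((\<lambda>s. snd (fst (c s))) has_vector_derivative
      \<beta> *\<^sub>R snd (fst (c s)) + cross3 n (snd (fst (c s))) + fst (fst (c s)) *\<^sub>R b + y) (at s)"
    and "((\<lambda>s. fst (snd (c s))) has_vector_derivative
      (\<beta> - \<alpha>) *\<^sub>R fst (snd (c s)) + cross3 n (fst (snd (c s))) + b) (at s)"
    and "((\<lambda>s. fst (snd (snd (c s)))) has_vector_derivative \<kappa> * fst (snd (snd (c s)))) (at s)"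
    and "((\<lambda>s. snd (snd (snd (c s)))) has_vector_derivative
      (2 * \<alpha> - 2 * \<beta> + \<kappa>) * snd (snd (snd (c s)))) (at s)"
proof -
  have F: "euler_field \<alpha> \<sigma> \<beta> \<kappa> n b y (c s) =
    ((\<alpha> * fst (fst (c s)) + \<sigma>,
      \<beta> *\<^sub>R snd (fst (c s)) + cross3 n (snd (fst (c s))) + fst (fst (c s)) *\<^sub>R b + y),
     ((\<beta> - \<alpha>) *\<^sub>R fst (snd (c s)) + cross3 n (fst (snd (c s))) + b, \<kappa> * fst (snd (snd (c s))),
      (2 * \<alpha> - 2 * \<beta> + \<kappa>) * snd (snd (snd (c s)))))"
    by (simp add: euler_field_def case_prod_unfold)
  note 0 = assms[unfolded F]
  note 1 = bounded_linear.has_vector_derivative[OF bounded_linear_fst 0]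
    and 2 = bounded_linear.has_vector_derivative[OF bounded_linear_snd 0]
  note 3 = bounded_linear.has_vector_derivative[OF bounded_linear_snd 2]
  show "((\<lambda>s. fst (fst (c s))) has_vector_derivative \<alpha> * fst (fst (c s)) + \<sigma>) (at s)"
    using bounded_linear.has_vector_derivative[OF bounded_linear_fst 1] by simp
  show "((\<lambda>s. snd (fst (c s))) has_vector_derivative
      \<beta> *\<^sub>R snd (fst (c s)) + cross3 n (snd (fst (c s))) + fst (fst (c s)) *\<^sub>R b + y) (at s)"
    using bounded_linear.has_vector_derivative[OF bounded_linear_snd 1] by simp
  show "((\<lambda>s. fst (snd (c s))) has_vector_derivative
      (\<beta> - \<alpha>) *\<^sub>R fst (snd (c s)) + cross3 n (fst (snd (c s))) + b) (at s)"
    using bounded_linear.has_vector_derivative[OF bounded_linear_fst 2] by simp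
  show "((\<lambda>s. fst (snd (snd (c s)))) has_vector_derivative \<kappa> * fst (snd (snd (c s)))) (at s)"
    using bounded_linear.has_vector_derivative[OF bounded_linear_fst 3] by simp
  show "((\<lambda>s. snd (snd (snd (c s)))) has_vector_derivative
      (2 * \<alpha> - 2 * \<beta> + \<kappa>) * snd (snd (snd (c s)))) (at s)"
    using bounded_linear.has_vector_derivative[OF bounded_linear_snd 3] by simp
qed

text \<open>The field is affine, so its inhomogeneous terms cancel in differences of solutions.
  Position is left out because its equation also contains the time coordinate, whose difference need
  not vanish.\<close>

lemma euler_field_ode_diff:
  fixes \<alpha> \<sigma> \<beta> \<kappa> :: real and n b y :: "real^3" and c d :: "real \<Rightarrow> phase"
  assumes c: "\<And>s. (c has_vector_derivative euler_field \<alpha> \<sigma> \<beta> \<kappa> n b y (c s)) (at s)"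
    and d: "\<And>s. (d has_vector_derivative euler_field \<alpha> \<sigma> \<beta> \<kappa> n b y (d s)) (at s)"
  shows "fst (fst (c s)) - fst (fst (d s)) = exp (\<alpha> * s) * (fst (fst (c 0)) - fst (fst (d 0)))"
    and "norm (fst (snd (c s)) - fst (snd (d s)))
      = exp ((\<beta> - \<alpha>) * s) * norm (fst (snd (c 0)) - fst (snd (d 0)))"
    and "fst (snd (snd (c s))) = exp (\<kappa> * s) * fst (snd (snd (c 0)))"
    and "snd (snd (snd (c s))) = exp ((2 * \<alpha> - 2 * \<beta> + \<kappa>) * s) * snd (snd (snd (c 0)))"
proof -
  note C = euler_field_components[OF c] and D = euler_field_components[OF d]
  show "fst (fst (c s)) - fst (fst (d s)) = exp (\<alpha> * s) * (fst (fst (c 0)) - fst (fst (d 0)))"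
    by (rule exponential_ode, rule has_vector_derivative_eq_rhs[OF has_vector_derivative_diff[OF C(1) D(1)]])
      (simp add: algebra_simps)
  show "norm (fst (snd (c s)) - fst (snd (d s)))
      = exp ((\<beta> - \<alpha>) * s) * norm (fst (snd (c 0)) - fst (snd (d 0)))"
    by (rule skew_ode_norm[where n = n], rule has_vector_derivative_eq_rhs[OF has_vector_derivative_diff[OF C(3) D(3)]])
      (simp add: algebra_simps Cross3.right_diff_distrib)
  show "fst (snd (snd (c s))) = exp (\<kappa> * s) * fst (snd (snd (c 0)))"
    by (rule exponential_ode) (rule C(4))
  show "snd (snd (snd (c s))) = exp ((2 * \<alpha> - 2 * \<beta> + \<kappa>) * s) * snd (snd (snd (c 0)))"
    by (rule exponential_ode) (rule C(5))
qed

text \<open>Pressure over density scales like the square of a velocity, which forces the factor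
  \<open>k * a\<^sup>2 / b\<^sup>2\<close> on density. The new time is \<open>a * t + s\<close>, so
  the drift \<open>t *\<^sub>R v\<close> adds only \<open>(1 / a) *\<^sub>R v\<close> to the
  velocity.\<close>

definition similitude ::
  "real \<Rightarrow> real \<Rightarrow> real \<Rightarrow> real \<Rightarrow> real^3 \<Rightarrow> real^3^3 \<Rightarrow> real^3 \<Rightarrow> phase \<Rightarrow> phase" where
  "similitude a b k s v R y = (\<lambda>((t, x), (u, p, q)).
     ((a * t + s, b *\<^sub>R (R *v x) + t *\<^sub>R v + y),
      ((b / a) *\<^sub>R (R *v u) + (1 / a) *\<^sub>R v, k * p, k * a\<^sup>2 / b\<^sup>2 * q)))"

definition similitudes :: "(phase \<Rightarrow> phase) set" where
  "similitudes = {similitude a b k s v R y | a b k s v R y.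
     0 < a \<and> 0 < b \<and> 0 < k \<and> orthogonal_matrix R}"

text \<open>Once the time coordinates agree, the difference of positions solves a homogeneous
  equation as well. Uniqueness identifies explicit flows with the one-parameter groups that
  membership in \<open>lie_algebra\<close> provides abstractly.\<close>

lemma euler_field_ode_unique:
  fixes \<alpha> \<sigma> \<beta> \<kappa> :: real and n b y :: "real^3" and c d :: "real \<Rightarrow> phase"
  assumes c: "\<And>s. (c has_vector_derivative euler_field \<alpha> \<sigma> \<beta> \<kappa> n b y (c s)) (at s)"
    and d: "\<And>s. (d has_vector_derivative euler_field \<alpha> \<sigma> \<beta> \<kappa> n b y (d s)) (at s)"
    and 0: "c 0 = d 0"
  shows "c s = d s"
proof -
  note C = euler_field_components[OF c] and D = euler_field_components[OF d]
  note E = euler_field_ode_diff[OF c d]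
  have T: "fst (fst (c s)) = fst (fst (d s))" for s
    using E(1)[of s] 0 by simp
  have "norm (snd (fst (c s)) - snd (fst (d s))) = exp (\<beta> * s) * norm (snd (fst (c 0)) - snd (fst (d 0)))"
    by (rule skew_ode_norm[where n = n], rule has_vector_derivative_eq_rhs[OF has_vector_derivative_diff[OF C(2) D(2)]])
      (simp add: algebra_simps Cross3.right_diff_distrib T)
  then have "snd (fst (c s)) = snd (fst (d s))" using 0 by simp
  moreover have "fst (snd (c s)) = fst (snd (d s))"
    using E(2)[of s] 0 by simp
  moreover have "snd (snd (c s)) = snd (snd (d s))"
    using E(3,4)[of s] euler_field_ode_diff(3,4)[OF d d, of s] 0 by (simp add: prod_eq_iff)
  ultimately show ?thesis using T by (simp add: prod_eq_iff)
qed

text \<open>The rotation is not computed. At time \<open>s\<close>, the velocity part without its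
  value on the orbit of the origin and without the factor
  \<open>exp ((\<beta> - \<alpha>) * s)\<close> preserves distances and fixes 0, so it is
  orthogonal. The translation parameters are read off the orbit of the origin
  \<open>m0\<close>.\<close>

lemma euler_field_flow_similitude:
  fixes \<alpha> \<sigma> \<beta> \<kappa> :: real and n b y :: "real^3" and c :: "real \<Rightarrow> phase \<Rightarrow> phase"
  assumes ode: "\<And>s m. ((\<lambda>s. c s m) has_vector_derivative euler_field \<alpha> \<sigma> \<beta> \<kappa> n b y (c s m)) (at s)"
    and c0: "\<And>m. c 0 m = m"
  shows "c s \<in> similitudes"
proof -
  define m0 :: phase where "m0 = ((0, 0), (0, 0, 0))"
  define w :: "real^3 \<Rightarrow> phase" where "w u = ((0, 0), (u, 0, 0))" for u
  define T where "T s m = fst (fst (c s m))" for s m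
  define X where "X s m = snd (fst (c s m))" for s m
  define U where "U s m = fst (snd (c s m))" for s m
  note C = euler_field_components[OF ode, folded T_def X_def U_def]
  note E = euler_field_ode_diff[OF ode ode, unfolded c0, folded T_def U_def]
  have T: "T s m = exp (\<alpha> * s) * fst (fst m) + T s m0" for s m
    using E(1)[of s m m0] by (simp add: m0_def)
  have Uw: "U s m = U s (w (fst (snd m)))" for s m
    using E(2)[of s m "w (fst (snd m))"] by (simp add: w_def)
  define \<rho> where "\<rho> u = exp (- (\<beta> - \<alpha>) * s) *\<^sub>R (U s (w u) - U s m0)" for u
  have U: "U s m = exp ((\<beta> - \<alpha>) * s) *\<^sub>R \<rho> (fst (snd m)) + U s m0" for m
    using Uw[of s m] by (simp add: \<rho>_def exp_add[symmetric] left_diff_distrib)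
  have "dist (\<rho> u) (\<rho> u') = dist u u'" for u u'
  proof -
    have "dist (\<rho> u) (\<rho> u') = exp (- (\<beta> - \<alpha>) * s) * norm (U s (w u) - U s (w u'))"
      by (simp add: \<rho>_def dist_norm scaleR_diff_right[symmetric])
    also have "\<dots> = norm (u - u')"
      unfolding E(2)[of s "w u" "w u'"] by (simp add: w_def mult.assoc[symmetric] exp_add[symmetric] left_diff_distrib)
    finally show ?thesis by (simp add: dist_norm)
  qed
  moreover have "\<rho> 0 = 0" by (simp add: \<rho>_def w_def m0_def)
  ultimately have "orthogonal_transformation \<rho>"
    by (simp add: orthogonal_transformation_isometry)
  then have R: "orthogonal_matrix (matrix \<rho>)" "matrix \<rho> *v x = \<rho> x" for x
    by (auto simp: orthogonal_transformation_matrix matrix_works)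
  \<comment> \<open>subtracting from the position multiples of solutions of the velocity equation leaves a solution
     of the homogeneous equation with initial value 0\<close>
  have X: "X s m = exp (\<beta> * s) *\<^sub>R \<rho> (snd (fst m)) + fst (fst m) *\<^sub>R (exp (\<alpha> * s) *\<^sub>R U s m0) + X s m0" for m
  proof -
    let ?x = "snd (fst m)" and ?t = "fst (fst m)"
    define z where "z s = (X s m - X s m0) - (T s m - T s m0) *\<^sub>R U s m0
       - exp (\<alpha> * s) *\<^sub>R (U s (w ?x) - U s m0)" for s
    have e: "((\<lambda>s. exp (\<alpha> * s)) has_vector_derivative \<alpha> * exp (\<alpha> * s)) (at s)" for s
      unfolding has_real_derivative_iff_has_vector_derivative[symmetric]
      by (auto intro!: derivative_eq_intros)
    have "norm (z s) = exp (\<beta> * s) * norm (z 0)" for s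
      unfolding z_def
      by (rule skew_ode_norm[where n = n], rule has_vector_derivative_eq_rhs,
        (rule has_vector_derivative_diff has_vector_derivative_scaleR C
           e[unfolded has_real_derivative_iff_has_vector_derivative[symmetric]]
           C(1)[unfolded has_real_derivative_iff_has_vector_derivative[symmetric]] DERIV_diff)+)
        (simp add: algebra_simps Cross3.right_diff_distrib cross_add_right cross_mult_right)
    moreover have "z 0 = 0"
      by (simp add: z_def X_def U_def T_def c0 w_def m0_def)
    ultimately have "z s = 0" by simp
    then show ?thesis
      using U[of "w ?x"] T[of s m]
      by (simp add: z_def w_def algebra_simps exp_add exp_diff)
  qed
  \<comment> \<open>\<open>similitude\<close> divides its boost parameter by the time factor, so the
    velocity \<open>U s m0\<close> enters multiplied by \<open>exp (\<alpha> * s)\<close>.\<close>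
  have "c s m = similitude (exp (\<alpha> * s)) (exp (\<beta> * s)) (exp (\<kappa> * s)) (T s m0) (exp (\<alpha> * s) *\<^sub>R U s m0)
      (matrix \<rho>) (X s m0) m" for m
  proof -
    have "exp (\<kappa> * s) * (exp (\<alpha> * s))\<^sup>2 / (exp (\<beta> * s))\<^sup>2 = exp ((2 * \<alpha> - 2 * \<beta> + \<kappa>) * s)"
      by (simp add: exp_double[symmetric] exp_add[symmetric] exp_diff[symmetric] algebra_simps)
    moreover have "exp (\<beta> * s) / exp (\<alpha> * s) = exp ((\<beta> - \<alpha>) * s)"
      by (simp add: exp_diff[symmetric] algebra_simps)
    ultimately show ?thesis
      using T[of s m] X[of m] U[of m] E(3,4)[of s m]
      by (simp add: similitude_def case_prod_unfold prod_eq_iff R T_def X_def U_def)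
  qed
  then have "c s = similitude (exp (\<alpha> * s)) (exp (\<beta> * s)) (exp (\<kappa> * s)) (T s m0) (exp (\<alpha> * s) *\<^sub>R U s m0)
      (matrix \<rho>) (X s m0)" by auto
  with R(1) show ?thesis unfolding similitudes_def by fastforce
qed

lemma one_parameter_group_similitude:
  assumes "lie_algebra (symmetry_group \<gamma>) = euler_fields_span" "one_parameter_group \<gamma> c X"
  shows "c s \<in> similitudes"
proof -
  have "X \<in> euler_fields_span"
    using assms lie_algebra_one_parameter_group by blast
  then obtain \<alpha> \<sigma> \<beta> \<kappa> n b y where X: "X = euler_field \<alpha> \<sigma> \<beta> \<kappa> n b y"
    unfolding euler_fields_span_iff by blast
  show ?thesis
    using one_parameter_group_ode[OF assms(2)] one_parameter_group_0[OF assms(2)]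
    unfolding X by (intro euler_field_flow_similitude) auto
qed

text \<open>Both inclusions of the hypothesis enter. One makes a field of the span the generator of
  a group of symmetries, which uniqueness identifies with \<open>e\<close>; the other places the
  generator of the conjugated group in the span again.\<close>

lemma euler_field_flow_symmetry:
  assumes "lie_algebra (symmetry_group \<gamma>) = euler_fields_span"
    and e: "\<And>s m. ((\<lambda>s. e s m) has_vector_derivative euler_field \<alpha> \<sigma> \<beta> \<kappa> n b y (e s m)) (at s)"
      "\<And>m. e 0 m = m"
  shows "e s \<in> carrier (symmetry_group \<gamma>)"
    and "\<phi> \<in> carrier (symmetry_group \<gamma>) \<Longrightarrow> \<phi> \<circ> e s \<circ> inverse_map \<phi> \<in> similitudes"
proof -
  have "euler_field \<alpha> \<sigma> \<beta> \<kappa> n b y \<in> lie_algebra (symmetry_group \<gamma>)"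
    unfolding assms(1) euler_fields_span_iff by blast
  then obtain c where c: "one_parameter_group \<gamma> c (euler_field \<alpha> \<sigma> \<beta> \<kappa> n b y)"
    by (auto simp: lie_algebra_one_parameter_group)
  have "c s m = e s m" for s m
    by (rule euler_field_ode_unique[OF one_parameter_group_ode[OF c] e(1)])
      (simp add: e(2) one_parameter_group_0[OF c])
  then have "c s = e s" for s by auto
  then have "e = c" by auto
  then show "e s \<in> carrier (symmetry_group \<gamma>)"
    using c by (auto simp: one_parameter_group_def)
  show "\<phi> \<circ> e s \<circ> inverse_map \<phi> \<in> similitudes" if "\<phi> \<in> carrier (symmetry_group \<gamma>)"
    using one_parameter_group_conj[OF c that] one_parameter_group_similitude[OF assms(1)]
    unfolding \<open>e = c\<close> by blast
qed

section \<open>Similitudes\<close>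

lemma similitude_apply:
  "similitude a b k s v R y ((t, x), (u, p, q)) =
     ((a * t + s, b *\<^sub>R (R *v x) + t *\<^sub>R v + y),
      ((b / a) *\<^sub>R (R *v u) + (1 / a) *\<^sub>R v, k * p, k * a\<^sup>2 / b\<^sup>2 * q))"
  by (simp add: similitude_def)

lemma similitude_comp:
  assumes "a \<noteq> 0" "a' \<noteq> 0" "b \<noteq> 0" "b' \<noteq> 0"
  shows "similitude a b k s v R y \<circ> similitude a' b' k' s' v' R' y' =
    similitude (a * a') (b * b') (k * k') (a * s' + s) (b *\<^sub>R (R *v v') + a' *\<^sub>R v) (R ** R')
      (b *\<^sub>R (R *v y') + s' *\<^sub>R v + y)"
proof
  fix m :: phase
  obtain t x u p q where m: "m = ((t, x), (u, p, q))" by (metis prod.exhaust)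
  show "(similitude a b k s v R y \<circ> similitude a' b' k' s' v' R' y') m =
    similitude (a * a') (b * b') (k * k') (a * s' + s) (b *\<^sub>R (R *v v') + a' *\<^sub>R v) (R ** R')
      (b *\<^sub>R (R *v y') + s' *\<^sub>R v + y) m"
    using assms
    by (simp add: m similitude_apply matrix_vector_right_distrib matrix_vector_mult_scaleR
        matrix_vector_mul_assoc[symmetric] algebra_simps power_mult_distrib)
qed

lemma matrix_uminus_vector: "(- mat 1) *v w = - (w :: real^'n)"
  by (simp add: matrix_vector_mult_def mat_def vec_eq_iff sum_negf if_distrib[where f = "\<lambda>x. x * _"]
      cong: if_cong)

lemma orthogonal_matrix_uminus_mat: "orthogonal_matrix (- mat 1 :: real^'n^'n)"
proof -
  have "orthogonal_transformation ((*v) (- mat 1 :: real^'n^'n))"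
    by (simp add: orthogonal_transformation_def matrix_uminus_vector)
  then show ?thesis by (simp add: orthogonal_transformation_matrix)
qed

lemma matrix_vector_minus: "A *v (- x) = - (A *v (x :: real^'n))"
  by (simp add: matrix_vector_mult_def vec_eq_iff sum_negf)

lemma orthogonal_matrix_norm: "orthogonal_matrix (R :: real^'n^'n) \<Longrightarrow> norm (R *v x) = norm x"
  using orthogonal_transformation_matrix[of "(*v) R"] orthogonal_transformation_norm by auto

text \<open>Position shows only the product \<open>b *\<^sub>R R\<close>. Orthogonal matrices
  preserve norms and the factors are positive, so the norm of one image vector separates
  \<open>b\<close> from \<open>R\<close>.\<close>

lemma similitude_inject:
  assumes eq: "similitude a b k s v R y = similitude a' b' k' s' v' R' y'"
    and pos: "0 < a" "0 < b" "0 < k" "orthogonal_matrix R" "0 < a'" "0 < b'" "0 < k'" "orthogonal_matrix R'"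
  shows "a = a'" "b = b'" "k = k'" "s = s'" "v = v'" "R = R'" "y = y'"
proof -
  note * = fun_cong[OF eq, of "((_, _), (_, _, _))", unfolded similitude_apply]
  show s: "s = s'" and y: "y = y'" using *[of 0 0 0 0 0] by auto
  show "a = a'" using *[of 1 0 0 0 0] s by auto
  show "v = v'" using *[of 1 0 0 0 0] y by auto
  show "k = k'" using *[of 0 0 0 1 0] by auto
  have x: "b *\<^sub>R (R *v x) = b' *\<^sub>R (R' *v x)" for x using *[of 0 x 0 0 0] y by auto
  have "norm (b *\<^sub>R (R *v axis 1 1)) = norm (b' *\<^sub>R (R' *v axis 1 1))"
    by (simp only: x)
  then show b: "b = b'" using pos by (simp add: orthogonal_matrix_norm)
  then show "R = R'" using x pos by (simp add: matrix_eq)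
qed

section \<open>Galilean transformations as similitudes without scaling\<close>

definition galilei :: "real \<Rightarrow> real^3 \<Rightarrow> real^3^3 \<Rightarrow> real^3 \<Rightarrow> phase \<Rightarrow> phase" where
  "galilei s v R y = similitude 1 1 1 s v R y"

lemma galilei_apply:
  "galilei s v R y ((t, x), (u, p, q)) = ((t + s, R *v x + t *\<^sub>R v + y), (R *v u + v, p, q))"
  by (simp add: galilei_def similitude_apply)

lemma galilei_comp:
  "galilei s v R y \<circ> galilei s' v' R' y' =
    galilei (s + s') (R *v v' + v) (R ** R') (R *v y' + s' *\<^sub>R v + y)"
  by (simp add: galilei_def similitude_comp add.commute)

lemma galilei_id: "galilei 0 0 (mat 1) 0 = id"
  by (auto simp: galilei_apply)

lemma galilei_inject:
  assumes "galilei s v R y = galilei s' v' R' y'" "orthogonal_matrix R" "orthogonal_matrix R'"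
  shows "s = s'" "v = v'" "R = R'" "y = y'"
  using similitude_inject[OF assms(1)[unfolded galilei_def]] assms(2,3) by auto

lemma parity_galilei: "parity = galilei 0 0 (- mat 1) 0"
  by (auto simp: fun_eq_iff parity_def galilei_apply matrix_uminus_vector)

section \<open>Half turns and a trace criterion for the identity\<close>

definition half_turn :: "real^3 \<Rightarrow> real^3^3" where
  "half_turn n = matrix (\<lambda>x. (2 * (n \<bullet> x)) *\<^sub>R n - x)"

lemma half_turn_apply: "half_turn n *v x = (2 * (n \<bullet> x)) *\<^sub>R n - x"
proof -
  have "linear (\<lambda>x. (2 * (n \<bullet> x)) *\<^sub>R n - x)"
    by (rule linearI) (simp_all add: inner_add_right algebra_simps)
  then show ?thesis
    unfolding half_turn_def by (intro matrix_works) (simp add: linear_def scalar_mult_eq_scaleR)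
qed

lemma half_turn_involution:
  assumes "norm n = 1" shows "half_turn n ** half_turn n = mat 1"
  using assms
  by (simp add: matrix_eq matrix_vector_mul_assoc[symmetric] half_turn_apply inner_diff_right norm_eq_1
      vec_eq_iff field_simps)

lemma half_turn_orthogonal:
  assumes "norm n = 1" shows "orthogonal_matrix (half_turn n)"
proof -
  have "orthogonal_transformation ((*v) (half_turn n))"
    using assms
    by (simp add: orthogonal_transformation_def half_turn_apply inner_diff_right inner_diff_left norm_eq_1
        inner_commute algebra_simps)
  then show ?thesis by (simp add: orthogonal_transformation_matrix)
qed

text \<open>A vector fixed by the half turn about an axis lies on that axis, and the coordinate axes
  meet only in 0.\<close>

lemma half_turn_fixed_imp_0:
  fixes w :: "real^3"
  assumes "\<And>n. norm n = 1 \<Longrightarrow> half_turn n *v w = w"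
  shows "w = 0"
proof -
  have "w $ j = (axis i 1 \<bullet> w) * axis i 1 $ j" for i j
    using assms[of "axis i 1"] by (simp add: half_turn_apply vec_eq_iff field_simps)
  from this[of 1 2] this[of 2 1] this[of 3 1] this[of 3 2] this[of 1 3] show ?thesis
    by (simp add: vec_eq_iff forall_3 axis_def)
qed

text \<open>The columns are unit vectors, so no diagonal entry exceeds 1. Trace 3 makes all of them
  equal to 1, which uses up the norm of each column.\<close>

lemma orthogonal_matrix_trace_3:
  fixes R :: "real^3^3"
  assumes "orthogonal_matrix R" "trace R = 3"
  shows "R = mat 1"
proof -
  have n: "(\<Sum>i\<in>UNIV. (R $ i $ j)\<^sup>2) = 1" for j
  proof -
    have "norm (column j R) = 1"
      using assms(1) orthogonal_matrix_orthonormal_columns by blast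
    then show ?thesis
      by (simp add: norm_vec_def L2_set_def column_def)
  qed
  have "R $ j $ j \<le> 1" for j
  proof -
    have "(R $ j $ j)\<^sup>2 \<le> 1"
      using n[of j] member_le_sum[of j UNIV "\<lambda>i. (R $ i $ j)\<^sup>2"] by simp
    then show ?thesis by (simp add: abs_square_le_1)
  qed
  from this[of 1] this[of 2] this[of 3] assms(2)
  have "R $ 1 $ 1 = 1" "R $ 2 $ 2 = 1" "R $ 3 $ 3 = 1"
    by (auto simp: trace_def sum_3)
  with n[of 1] n[of 2] n[of 3] show ?thesis
    by (auto simp: sum_3 vec_eq_iff forall_3 mat_def add_nonneg_eq_0_iff)
qed

section \<open>Conjugates of boosts, time translations and half turns\<close>

definition conj_by :: "('a \<Rightarrow> 'a) \<Rightarrow> ('a \<Rightarrow> 'a) \<Rightarrow> 'a \<Rightarrow> 'a" where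
  "conj_by \<phi> g = \<phi> \<circ> g \<circ> inverse_map \<phi>"

lemma conj_by_comp: "bij \<phi> \<Longrightarrow> conj_by \<phi> g \<circ> conj_by \<phi> h = conj_by \<phi> (g \<circ> h)"
  by (auto simp: conj_by_def inverse_map_comp)

lemma conj_by_id: "bij \<phi> \<Longrightarrow> conj_by \<phi> id = id"
  by (auto simp: conj_by_def inverse_map_comp)

lemma conj_by_inverse: "bij \<phi> \<Longrightarrow> conj_by \<phi> (conj_by (inverse_map \<phi>) g) = g"
  by (auto simp: conj_by_def inverse_map_comp inv_inv_eq)

definition galilean_transformations :: "(phase \<Rightarrow> phase) set" where
  "galilean_transformations = {galilei s v R y | s v R y. orthogonal_matrix R}"

lemma galilean_transformations_comp:
  "g \<in> galilean_transformations \<Longrightarrow> h \<in> galilean_transformations \<Longrightarrow> g \<circ> h \<in> galilean_transformations"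
  unfolding galilean_transformations_def using galilei_comp orthogonal_matrix_mul by fastforce

lemma similitudesE:
  assumes "g \<in> similitudes"
  obtains a b k s v R y where "g = similitude a b k s v R y" "0 < a" "0 < b" "0 < k" "orthogonal_matrix R"
  using assms unfolding similitudes_def by blast

locale euler_lie_algebra =
  fixes \<gamma> :: real
  assumes lie_algebra: "lie_algebra (symmetry_group \<gamma>) = euler_fields_span"
begin

text \<open>What later arguments need of a map lying on a flow. It is stated for every symmetry
  \<phi>, so that it can be applied to a symmetry and to its inverse alike.\<close>

definition normal_similitude :: "(phase \<Rightarrow> phase) \<Rightarrow> bool" where
  "normal_similitude g \<longleftrightarrow> g \<in> carrier (symmetry_group \<gamma>) \<and>
     (\<forall>\<phi>\<in>carrier (symmetry_group \<gamma>). conj_by \<phi> g \<in> similitudes)"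

lemma flow_normal_similitude:
  assumes "\<And>s m. ((\<lambda>s. e s m) has_vector_derivative euler_field \<alpha> \<sigma> \<beta> \<kappa> n b y (e s m)) (at s)"
    and "\<And>m. e 0 m = m"
  shows "normal_similitude (e s)"
  using euler_field_flow_symmetry[OF lie_algebra assms]
  by (simp add: normal_similitude_def conj_by_def)

lemma boost_normal_similitude: "normal_similitude (galilei 0 v (mat 1) y)"
proof -
  let ?e = "\<lambda>s. galilei 0 (s *\<^sub>R v) (mat 1) (s *\<^sub>R y)"
  have "normal_similitude (?e 1)"
  proof (rule flow_normal_similitude[where e = ?e])
    fix s :: real and m :: phase
    obtain t x u p q where m: "m = ((t, x), (u, p, q))" by (metis prod.exhaust)
    show "((\<lambda>s. ?e s m) has_vector_derivative euler_field 0 0 0 0 0 v y (?e s m)) (at s)"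
      unfolding m galilei_apply euler_field_def
      by (auto intro!: derivative_eq_intros has_vector_derivative_Pair
          simp: has_vector_derivative_def zero_prod_def algebra_simps)
    show "?e 0 m = m" by (simp add: m galilei_apply)
  qed
  then show ?thesis by simp
qed

lemma time_normal_similitude: "normal_similitude (galilei \<tau> 0 (mat 1) 0)"
proof -
  let ?e = "\<lambda>s. galilei (s * \<tau>) 0 (mat 1) 0"
  have "normal_similitude (?e 1)"
  proof (rule flow_normal_similitude[where e = ?e])
    fix s :: real and m :: phase
    obtain t x u p q where m: "m = ((t, x), (u, p, q))" by (metis prod.exhaust)
    show "((\<lambda>s. ?e s m) has_vector_derivative euler_field 0 \<tau> 0 0 0 0 0 (?e s m)) (at s)"
      unfolding m galilei_apply euler_field_def
      by (auto intro!: derivative_eq_intros has_vector_derivative_Pair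
          simp: has_vector_derivative_def zero_prod_def algebra_simps)
    show "?e 0 m = m" by (simp add: m galilei_apply)
  qed
  then show ?thesis by simp
qed

text \<open>Positive factors are exponentials, so the scaling is the time-one map of a flow whose
  rates are the logarithms.\<close>

lemma scaling_normal_similitude:
  assumes "0 < a" "0 < b" "0 < k"
  shows "normal_similitude (similitude a b k 0 0 (mat 1) 0)"
proof -
  let ?e = "\<lambda>s. similitude (exp (s * ln a)) (exp (s * ln b)) (exp (s * ln k)) 0 0 (mat 1) 0"
  have "normal_similitude (?e 1)"
  proof (rule flow_normal_similitude[where e = ?e])
    fix s :: real and m :: phase
    obtain t x u p q where m: "m = ((t, x), (u, p, q))" by (metis prod.exhaust)
    have e: "?e s m = ((exp (s * ln a) * t, exp (s * ln b) *\<^sub>R x),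
      (exp (s * (ln b - ln a)) *\<^sub>R u, exp (s * ln k) * p, exp (s * (2 * ln a - 2 * ln b + ln k)) * q))" for s
    proof -
      have "exp (s * ln k) * (exp (s * ln a))\<^sup>2 / (exp (s * ln b))\<^sup>2
          = exp (s * (2 * ln a - 2 * ln b + ln k))"
        by (simp add: exp_double[symmetric] exp_add[symmetric] exp_diff[symmetric] algebra_simps)
      then show ?thesis
        by (simp add: m similitude_apply exp_diff[symmetric] right_diff_distrib)
    qed
    show "((\<lambda>s. ?e s m) has_vector_derivative
        euler_field (ln a) 0 (ln b) (ln k) 0 0 0 (?e s m)) (at s)"
      unfolding e euler_field_def
      by (auto intro!: derivative_eq_intros has_vector_derivative_Pair
          simp: has_vector_derivative_def zero_prod_def algebra_simps)
    show "?e 0 m = m" by (simp add: m similitude_apply)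
  qed
  then show ?thesis using assms by simp
qed

lemma half_turn_normal_similitude:
  assumes "norm n = 1"
  shows "normal_similitude (galilei 0 0 (half_turn n) 0)"
proof -
  \<comment> \<open>Rodrigues' formula for the rotation by the angle \<open>s\<close> about
    \<open>n\<close>; the angle \<open>pi\<close> gives the half turn.\<close>
  define r where "r s x = cos s *\<^sub>R x + sin s *\<^sub>R cross3 n x + ((1 - cos s) * (n \<bullet> x)) *\<^sub>R n"
    for s :: real and x
  define e :: "real \<Rightarrow> phase \<Rightarrow> phase"
    where "e s = (\<lambda>((t, x), (u, p, q)). ((t, r s x), (r s u, p, q)))" for s
  have r: "((\<lambda>s. r s x) has_vector_derivative cross3 n (r s x)) (at s)" for s x
    using assms unfolding r_def
    by (auto intro!: derivative_eq_intros
        simp: has_vector_derivative_def cross_add_right cross_mult_right Cross3.right_diff_distrib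
          Lagrange norm_eq_1 algebra_simps)
  have "normal_similitude (e pi)"
  proof (rule flow_normal_similitude[where e = e])
    fix s :: real and m :: phase
    obtain t x u p q where m: "m = ((t, x), (u, p, q))" by (metis prod.exhaust)
    show "((\<lambda>s. e s m) has_vector_derivative euler_field 0 0 0 0 n 0 0 (e s m)) (at s)"
      unfolding m e_def euler_field_def
      by (auto intro!: has_vector_derivative_Pair r)
    show "e 0 m = m" by (simp add: m e_def r_def)
  qed
  moreover have "e pi = galilei 0 0 (half_turn n) 0"
    by (auto simp: e_def r_def galilei_apply half_turn_apply)
  ultimately show ?thesis by simp
qed

lemma normal_similitude_conj:
  assumes "normal_similitude g" "\<phi> \<in> carrier (symmetry_group \<gamma>)"
  obtains a b k s v R y where "conj_by \<phi> g = similitude a b k s v R y"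
    "0 < a" "0 < b" "0 < k" "orthogonal_matrix R"
  using assms similitudesE unfolding normal_similitude_def by metis

text \<open>The conjugates by \<open>h i\<close> move \<open>g\<close> to the identity, while conjugation preserves the scaling
  factors and the trace of the rotation.\<close>

lemma contractible_conj:
  assumes \<phi>: "\<phi> \<in> carrier (symmetry_group \<gamma>)"
    and g: "normal_similitude g" "\<And>i :: nat. normal_similitude (h i)" "\<And>i. normal_similitude (g' i)"
    and comm: "\<And>i. h i \<circ> g = g' i \<circ> h i"
    and lim: "\<And>m. (\<lambda>i. g' i m) \<longlonglongrightarrow> m"
  obtains s v y where "conj_by \<phi> g = galilei s v (mat 1) y"
proof -
  have bij: "bij \<phi>" using \<phi> by (rule symmetry_group_bij)
  obtain a b k s v R y where G: "conj_by \<phi> g = similitude a b k s v R y"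
    and pos: "0 < a" "0 < b" "0 < k" and ort: "orthogonal_matrix R"
    using g(1) \<phi> by (rule normal_similitude_conj)
  have G': "\<exists>s v R' y. conj_by \<phi> (g' i) = similitude a b k s v R' y \<and> orthogonal_matrix R' \<and> trace R' = trace R"
    for i
  proof -
    obtain a1 b1 k1 s1 v1 R1 y1 where H: "conj_by \<phi> (h i) = similitude a1 b1 k1 s1 v1 R1 y1"
      and pos1: "0 < a1" "0 < b1" "0 < k1" and ort1: "orthogonal_matrix R1"
      using g(2) \<phi> by (rule normal_similitude_conj)
    obtain a2 b2 k2 s2 v2 R2 y2 where G': "conj_by \<phi> (g' i) = similitude a2 b2 k2 s2 v2 R2 y2"
      and pos2: "0 < a2" "0 < b2" "0 < k2" and ort2: "orthogonal_matrix R2"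
      using g(3) \<phi> by (rule normal_similitude_conj)
    \<comment> \<open>Scaling factors commute and cancel in this relation, whereas the rotations are
      only conjugate to each other; hence the trace is compared instead of the matrix.\<close>
    have "conj_by \<phi> (h i) \<circ> conj_by \<phi> g = conj_by \<phi> (g' i) \<circ> conj_by \<phi> (h i)"
      by (simp add: conj_by_comp[OF bij] comm)
    note * = similitude_inject[OF this[unfolded G H G' similitude_comp[OF
          pos1(1)[THEN less_imp_neq, symmetric] pos(1)[THEN less_imp_neq, symmetric]
          pos1(2)[THEN less_imp_neq, symmetric] pos(2)[THEN less_imp_neq, symmetric]]
        similitude_comp[OF
          pos2(1)[THEN less_imp_neq, symmetric] pos1(1)[THEN less_imp_neq, symmetric]
          pos2(2)[THEN less_imp_neq, symmetric] pos1(2)[THEN less_imp_neq, symmetric]]]]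
    have "a1 * a = a2 * a1" "b1 * b = b2 * b1" "k1 * k = k2 * k1" "R1 ** R = R2 ** R1"
      by (rule *; simp add: pos pos1 pos2 ort ort1 ort2 orthogonal_matrix_mul)+
    moreover have "trace R2 = trace R"
    proof -
      have "R2 = R1 ** R ** transpose R1"
        using ort1 \<open>R1 ** R = R2 ** R1\<close>
        by (simp add: orthogonal_matrix_def matrix_mul_assoc[symmetric])
      also have "trace \<dots> = trace (transpose R1 ** (R1 ** R))"
        by (rule trace_mul_sym)
      also have "\<dots> = trace R"
        using ort1 by (simp add: orthogonal_matrix_def matrix_mul_assoc)
      finally show ?thesis .
    qed
    ultimately show ?thesis using G' pos1 ort2 by auto
  qed
  have "isCont \<phi> m" for m
    using smooth_on_differentiable[OF open_UNIV diffeomorphism_smooth(1)] \<phi>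
      symmetry_group_diffeomorphism differentiable_imp_continuous_within by blast
  then have "(\<lambda>i. \<phi> (g' i (inverse_map \<phi> m))) \<longlonglongrightarrow> \<phi> (inverse_map \<phi> m)" for m
    by (rule isCont_tendsto_compose[OF _ lim])
  then have L: "(\<lambda>i. conj_by \<phi> (g' i) m) \<longlonglongrightarrow> m" for m
    by (simp add: conj_by_def inverse_map_comp[OF bij])
  let ?z = "((0, 0), (0, 0, 0)) :: phase"
  have "(\<lambda>i. fst (fst (conj_by \<phi> (g' i) ((1, 0), (0, 0, 0)))) - fst (fst (conj_by \<phi> (g' i) ?z)))
      \<longlonglongrightarrow> fst (fst (((1, 0), (0, 0, 0)) :: phase)) - fst (fst ?z)"
    by (intro tendsto_intros L)
  moreover have "fst (fst (conj_by \<phi> (g' i) ((1, 0), (0, 0, 0)))) - fst (fst (conj_by \<phi> (g' i) ?z)) = a" for i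
    using G'[of i] by (auto simp: similitude_apply)
  ultimately have a: "a = 1"
    by (simp add: LIMSEQ_const_iff)
  have "(\<lambda>i. fst (snd (snd (conj_by \<phi> (g' i) ((0, 0), (0, 1, 0)))))) \<longlonglongrightarrow>
      fst (snd (snd (((0, 0), (0, 1, 0)) :: phase)))"
    by (intro tendsto_intros L)
  moreover have "fst (snd (snd (conj_by \<phi> (g' i) ((0, 0), (0, 1, 0))))) = k" for i
    using G'[of i] by (auto simp: similitude_apply)
  ultimately have k: "k = 1"
    by (simp add: LIMSEQ_const_iff)
  \<comment> \<open>Subtracting the image of the origin removes the translation part, which may vary
    with \<open>i\<close>, and leaves the linear part. Its rotation may vary as well, so only norm
    and trace are passed to the limit.\<close>
  define D where "D i x = snd (fst (conj_by \<phi> (g' i) ((0, x), (0, 0, 0)))) - snd (fst (conj_by \<phi> (g' i) ?z))" for i x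
  have D: "(\<lambda>i. D i x) \<longlonglongrightarrow> x" for x
  proof -
    have "(\<lambda>i. D i x) \<longlonglongrightarrow> snd (fst (((0, x), (0, 0, 0)) :: phase)) - snd (fst ?z)"
      unfolding D_def by (intro tendsto_intros L)
    then show ?thesis by simp
  qed
  have R': "\<exists>R'. (\<forall>x. D i x = b *\<^sub>R (R' *v x)) \<and> orthogonal_matrix R' \<and> trace R' = trace R" for i
    using G'[of i] by (force simp: D_def similitude_apply)
  have "norm (D i (axis 1 1)) = b" for i
    using R'[of i] pos by (auto simp: orthogonal_matrix_norm)
  then have b: "b = 1"
    using tendsto_norm[OF D[of "axis 1 1"]] by (simp add: LIMSEQ_const_iff)
  have "(\<lambda>i. \<Sum>j\<in>UNIV. D i (axis j 1) $ j) \<longlonglongrightarrow> (\<Sum>j\<in>UNIV. (axis j 1 :: real^3) $ j)"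
    by (intro tendsto_intros D)
  moreover have "(\<Sum>j\<in>UNIV. D i (axis j 1) $ j) = trace R" for i
    using R'[of i] b by (auto simp: trace_def matrix_vector_mul_component inner_axis)
  ultimately have "trace R = 3"
    by (simp add: LIMSEQ_const_iff sum_3)
  then have "R = mat 1" using ort by (intro orthogonal_matrix_trace_3)
  then show thesis using that G a b k by (simp add: galilei_def)
qed

text \<open>Scaling space by \<open>1 / real (Suc i)\<close> at fixed time shrinks \<open>v\<close>
  and \<open>y\<close> together. A time shift \<open>s\<close> survives this argument and is
  excluded in \<open>conj_boost\<close>.\<close>

lemma conj_boost_galilei:
  assumes "\<phi> \<in> carrier (symmetry_group \<gamma>)"
  obtains s v' y' where "conj_by \<phi> (galilei 0 v (mat 1) y) = galilei s v' (mat 1) y'"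
proof (rule contractible_conj[OF assms boost_normal_similitude])
  let ?r = "\<lambda>i. 1 / real (Suc i)"
  show "normal_similitude (similitude 1 (?r i) 1 0 0 (mat 1) 0)" for i
    by (rule scaling_normal_similitude) auto
  show "normal_similitude (galilei 0 (?r i *\<^sub>R v) (mat 1) (?r i *\<^sub>R y))" for i
    by (rule boost_normal_similitude)
  show "similitude 1 (?r i) 1 0 0 (mat 1) 0 \<circ> galilei 0 v (mat 1) y =
      galilei 0 (?r i *\<^sub>R v) (mat 1) (?r i *\<^sub>R y) \<circ> similitude 1 (?r i) 1 0 0 (mat 1) 0" for i
    by (simp add: galilei_def similitude_comp)
  have r: "?r \<longlonglongrightarrow> 0" by (rule LIMSEQ_Suc[OF lim_1_over_n])
  fix m :: phase
  obtain t x u p q where m: "m = ((t, x), (u, p, q))" by (metis prod.exhaust)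
  have "(\<lambda>i. ((t + 0, x + t *\<^sub>R ?r i *\<^sub>R v + ?r i *\<^sub>R y), (u + ?r i *\<^sub>R v, p, q))) \<longlonglongrightarrow>
      ((t + 0, x + t *\<^sub>R 0 *\<^sub>R v + 0 *\<^sub>R y), (u + 0 *\<^sub>R v, p, q))"
    by (intro tendsto_intros r)
  then show "(\<lambda>i. galilei 0 (?r i *\<^sub>R v) (mat 1) (?r i *\<^sub>R y) m) \<longlonglongrightarrow> m"
    by (simp add: m galilei_apply)
qed (use that in blast)

text \<open>Here time alone is scaled. A boost and a translation may appear in the conjugate, but
  they stay inside the Galilean transformations.\<close>

lemma conj_time_galilei:
  assumes "\<phi> \<in> carrier (symmetry_group \<gamma>)"
  obtains s v' y' where "conj_by \<phi> (galilei \<tau> 0 (mat 1) 0) = galilei s v' (mat 1) y'"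
proof (rule contractible_conj[OF assms time_normal_similitude])
  let ?r = "\<lambda>i. 1 / real (Suc i)"
  show "normal_similitude (similitude (?r i) 1 1 0 0 (mat 1) 0)" for i
    by (rule scaling_normal_similitude) auto
  show "normal_similitude (galilei (?r i * \<tau>) 0 (mat 1) 0)" for i
    by (rule time_normal_similitude)
  show "similitude (?r i) 1 1 0 0 (mat 1) 0 \<circ> galilei \<tau> 0 (mat 1) 0 =
      galilei (?r i * \<tau>) 0 (mat 1) 0 \<circ> similitude (?r i) 1 1 0 0 (mat 1) 0" for i
    by (simp add: galilei_def similitude_comp)
  have r: "?r \<longlonglongrightarrow> 0" by (rule LIMSEQ_Suc[OF lim_1_over_n])
  fix m :: phase
  obtain t x u p q where m: "m = ((t, x), (u, p, q))" by (metis prod.exhaust)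
  have "(\<lambda>i. ((t + ?r i * \<tau>, x), (u, p, q))) \<longlonglongrightarrow> ((t + 0 * \<tau>, x), (u, p, q))"
    by (intro tendsto_intros r)
  then show "(\<lambda>i. galilei (?r i * \<tau>) 0 (mat 1) 0 m) \<longlonglongrightarrow> m"
    by (simp add: m galilei_apply)
qed (use that in blast)

lemma conj_half_turn_galilei:
  assumes \<phi>: "\<phi> \<in> carrier (symmetry_group \<gamma>)" and n: "norm n = 1"
  obtains s v R y where "conj_by \<phi> (galilei 0 0 (half_turn n) 0) = galilei s v R y" "orthogonal_matrix R"
proof -
  have bij: "bij \<phi>" using \<phi> by (rule symmetry_group_bij)
  obtain a b k s v R y where G: "conj_by \<phi> (galilei 0 0 (half_turn n) 0) = similitude a b k s v R y"
    and pos: "0 < a" "0 < b" "0 < k" and ort: "orthogonal_matrix R"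
    using half_turn_normal_similitude[OF n] \<phi> by (rule normal_similitude_conj)
  have "similitude a b k s v R y \<circ> similitude a b k s v R y = conj_by \<phi> id"
    by (simp add: G[symmetric] conj_by_comp[OF bij] galilei_comp half_turn_involution n galilei_id)
  then have "similitude a b k s v R y \<circ> similitude a b k s v R y = similitude 1 1 1 0 0 (mat 1) 0"
    using galilei_id by (simp add: conj_by_id[OF bij] galilei_def)
  note * = similitude_inject[OF this[unfolded similitude_comp[OF
      pos(1)[THEN less_imp_neq, symmetric] pos(1)[THEN less_imp_neq, symmetric]
      pos(2)[THEN less_imp_neq, symmetric] pos(2)[THEN less_imp_neq, symmetric]]]]
  have "a * a = 1" "b * b = 1" "k * k = 1"
    by (rule *; simp add: pos ort orthogonal_matrix_mul orthogonal_matrix_id)+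
  then have "a = 1" "b = 1" "k = 1"
    using pos by (auto simp: square_eq_1_iff)
  then show thesis using that G ort by (simp add: galilei_def)
qed

text \<open>Two vectors do not span the space, so some axis \<open>n\<close> is orthogonal to
  \<open>v\<close> and \<open>y\<close>, and the half turn about it inverts both. Then boost, half
  turn, boost compose to the half turn again. In the conjugated relation this adds
  \<open>2 * s\<close> to the time shift \<open>s1\<close>, so \<open>s\<close> vanishes.\<close>

lemma conj_boost:
  assumes \<phi>: "\<phi> \<in> carrier (symmetry_group \<gamma>)"
  obtains v' y' where "conj_by \<phi> (galilei 0 v (mat 1) y) = galilei 0 v' (mat 1) y'"
proof -
  have bij: "bij \<phi>" using \<phi> by (rule symmetry_group_bij)
  have "dim {v, y} < DIM(real^3)"
    using dim_le_card[of "{v, y}" "{v, y}"] card_insert_le_m1[of 2 "{y}" v] by (simp add: span_superset)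
  then obtain n0 where n0: "n0 \<noteq> 0" "\<And>w. w \<in> span {v, y} \<Longrightarrow> orthogonal n0 w"
    by (rule orthogonal_to_subspace_exists) blast
  define n where "n = n0 /\<^sub>R norm n0"
  have n: "norm n = 1" "n \<bullet> v = 0" "n \<bullet> y = 0"
    using n0(1) n0(2)[of v] n0(2)[of y] by (auto simp: n_def span_base orthogonal_def)
  obtain s v' y' where B: "conj_by \<phi> (galilei 0 v (mat 1) y) = galilei s v' (mat 1) y'"
    using \<phi> by (rule conj_boost_galilei)
  obtain s1 v1 R1 y1 where H: "conj_by \<phi> (galilei 0 0 (half_turn n) 0) = galilei s1 v1 R1 y1"
    and ort: "orthogonal_matrix R1"
    using \<phi> n(1) by (rule conj_half_turn_galilei)
  have "galilei 0 v (mat 1) y \<circ> galilei 0 0 (half_turn n) 0 \<circ> galilei 0 v (mat 1) y = galilei 0 0 (half_turn n) 0"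
    by (simp add: galilei_comp half_turn_apply n)
  then have "galilei s v' (mat 1) y' \<circ> galilei s1 v1 R1 y1 \<circ> galilei s v' (mat 1) y' = galilei s1 v1 R1 y1"
    unfolding B[symmetric] H[symmetric] by (simp only: conj_by_comp[OF bij])
  then have "s = 0"
    using galilei_inject(1) ort by (fastforce simp: galilei_comp)
  then show thesis using that B by simp
qed

end

section \<open>Conjugates of parity\<close>

lemma homogeneous_differentiable_linear:
  fixes f :: "'a::real_normed_vector \<Rightarrow> real"
  assumes "f differentiable (at 0)" and hom: "\<And>k z. 0 < k \<Longrightarrow> f (k *\<^sub>R z) = k * f z"
  shows "linear f"
proof -
  obtain D where D: "(f has_derivative D) (at 0)"
    using assms(1) by (auto simp: differentiable_def)
  have f0: "f 0 = 0" using hom[of 2 0] by simp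
  have "f z = D z" for z
  proof -
    have "((\<lambda>r. f (r *\<^sub>R z)) has_derivative (\<lambda>r. D (r *\<^sub>R z))) (at 0)"
      by (rule diff_chain_at[of "\<lambda>r. r *\<^sub>R z" _ 0 f, unfolded o_def])
        (auto intro!: derivative_eq_intros simp: D)
    moreover have "D (r *\<^sub>R z) = D z * r" for r
      using linear_cmul[OF has_derivative_linear[OF D]] by simp
    ultimately have "((\<lambda>r. f (r *\<^sub>R z)) has_field_derivative D z) (at 0)"
      by (simp add: has_field_derivative_def)
    then have "((\<lambda>h. (f ((0 + h) *\<^sub>R z) - f (0 *\<^sub>R z)) / h) \<longlongrightarrow> D z) (at_right 0)"
      unfolding DERIV_def by (rule tendsto_mono[rotated]) (simp add: at_le)
    moreover have "\<forall>\<^sub>F h in at_right 0. (f ((0 + h) *\<^sub>R z) - f (0 *\<^sub>R z)) / h = f z"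
      by (auto simp: eventually_at_filter f0 hom)
    ultimately have "((\<lambda>h. f z) \<longlongrightarrow> D z) (at_right (0::real))"
      by (rule Lim_transform_eventually)
    then show ?thesis by (simp add: tendsto_const_iff)
  qed
  then have "f = D" by auto
  then show ?thesis using has_derivative_linear[OF D] by simp
qed

text \<open>The commutation hypotheses leave the translation part of the commuting maps unspecified,
  since conjugation determines them only up to boosts and translations.\<close>

lemma boost_inverting_map:
  fixes \<psi> :: "phase \<Rightarrow> phase"
  assumes boost: "\<And>v y. \<psi> \<circ> galilei 0 v (mat 1) y = galilei 0 (- v) (mat 1) (- y) \<circ> \<psi>"
    and time: "\<And>s. \<exists>v y. \<psi> \<circ> galilei s v (mat 1) y = galilei s v (mat 1) y \<circ> \<psi>"
    and scale: "\<And>a b k. 0 < a \<Longrightarrow> 0 < b \<Longrightarrow> 0 < k \<Longrightarrow>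
      \<exists>v y. \<psi> \<circ> similitude a b k 0 v (mat 1) y = similitude a b k 0 v (mat 1) y \<circ> \<psi>"
    and half: "\<And>n. norm n = 1 \<Longrightarrow>
      \<exists>v y. \<psi> \<circ> galilei 0 v (half_turn n) y = galilei 0 v (half_turn n) y \<circ> \<psi>"
    and diff: "\<psi> differentiable (at 0)"
  obtains U0 X0 c d where
    "\<And>t x u p q. \<psi> ((t, x), (u, p, q)) = ((t, X0 + t *\<^sub>R U0 - x), (U0 - u, c * p, d * q))"
proof -
  define Z where "Z t p q = \<psi> ((t, 0), (0, p, q))" for t p q
  define T where "T t p q = fst (fst (Z t p q))" for t p q
  define X where "X t p q = snd (fst (Z t p q))" for t p q
  define U where "U t p q = fst (snd (Z t p q))" for t p q
  define P where "P t p q = fst (snd (snd (Z t p q)))" for t p q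
  define Q where "Q t p q = snd (snd (snd (Z t p q)))" for t p q
  have Z: "\<psi> ((t, 0), (0, p, q)) = ((T t p q, X t p q), (U t p q, P t p q, Q t p q))" for t p q
    by (simp add: T_def X_def U_def P_def Q_def Z_def)
  \<comment> \<open>Boosting by \<open>u\<close> and translating by \<open>x - t *\<^sub>R u\<close>
    carries \<open>((t, 0), (0, p, q))\<close> to a general point, so \<psi> is known from its
    values \<open>Z\<close> on this slice.\<close>
  have \<psi>: "\<psi> ((t, x), (u, p, q)) = ((T t p q, X t p q - T t p q *\<^sub>R u + t *\<^sub>R u - x), (U t p q - u, P t p q, Q t p q))"
    for t x u p q
    using fun_cong[OF boost[of u "x - t *\<^sub>R u"], of "((t, 0), (0, p, q))"]
    by (simp add: galilei_apply Z algebra_simps)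
  have half': "\<exists>v y. \<forall>t p q. U t p q - half_turn n *v U t p q = 2 *\<^sub>R v \<and>
      X t p q - half_turn n *v X t p q = (2 * T t p q) *\<^sub>R v + 2 *\<^sub>R y" if n: "norm n = 1" for n
  proof -
    obtain v y where e: "\<psi> \<circ> galilei 0 v (half_turn n) y = galilei 0 v (half_turn n) y \<circ> \<psi>"
      using half[OF n] by blast
    have "U t p q - half_turn n *v U t p q = 2 *\<^sub>R v \<and>
      X t p q - half_turn n *v X t p q = (2 * T t p q) *\<^sub>R v + 2 *\<^sub>R y" for t p q
      using fun_cong[OF e, of "((t, 0), (0, p, q))"]
      by (simp add: galilei_apply Z \<psi> vec_eq_iff algebra_simps)
    then show ?thesis by blast
  qed
  have d: "b - b' = a - a'" if "a - b = c" "a' - b' = c" for a b a' b' c :: "real^3"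
    using that by (auto simp: diff_eq_eq)
  \<comment> \<open>The vector \<open>v\<close> in \<open>half'\<close> depends on \<open>n\<close>
    but not on the point, so a difference of two values of \<open>U\<close> is fixed by every half
    turn.\<close>
  have "U t p q - U 0 0 0 = 0" for t p q
  proof (rule half_turn_fixed_imp_0)
    fix n :: "real^3" assume "norm n = 1"
    then obtain v where "\<And>t p q. U t p q - half_turn n *v U t p q = 2 *\<^sub>R v"
      using half' by blast
    then show "half_turn n *v (U t p q - U 0 0 0) = U t p q - U 0 0 0"
      unfolding matrix_vector_mult_diff_distrib by (intro d)
  qed
  then obtain U0 where U: "\<And>t p q. U t p q = U0" by (metis right_minus_eq)
  \<comment> \<open>Subtracting \<open>T t p q *\<^sub>R U0\<close> removes the point-dependent
    right-hand side of the half-turn relation.\<close>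
  define X' where "X' t p q = X t p q - T t p q *\<^sub>R U0" for t p q
  have "X' t p q - X' 0 0 0 = 0" for t p q
  proof (rule half_turn_fixed_imp_0)
    fix n :: "real^3" assume "norm n = 1"
    then obtain v y where e: "U0 - half_turn n *v U0 = 2 *\<^sub>R v"
      "\<And>t p q. X t p q - half_turn n *v X t p q = (2 * T t p q) *\<^sub>R v + 2 *\<^sub>R y"
      using half' unfolding U by meson
    have "X' t p q - half_turn n *v X' t p q = 2 *\<^sub>R y" for t p q
    proof -
      have "X' t p q - half_turn n *v X' t p q
        = (X t p q - half_turn n *v X t p q) - T t p q *\<^sub>R (U0 - half_turn n *v U0)"
        by (simp add: X'_def matrix_vector_mult_diff_distrib matrix_vector_mult_scaleR algebra_simps)
      then show ?thesis unfolding e by (simp add: mult.commute)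
    qed
    then show "half_turn n *v (X' t p q - X' 0 0 0) = X' t p q - X' 0 0 0"
      unfolding matrix_vector_mult_diff_distrib by (intro d)
  qed
  then obtain X0 where "\<And>t p q. X' t p q = X0" by (metis right_minus_eq)
  then have X: "X t p q = X0 + T t p q *\<^sub>R U0" for t p q
    by (simp add: X'_def diff_eq_eq)
  have time': "T (t + s) p q = T t p q + s \<and> P (t + s) p q = P t p q \<and> Q (t + s) p q = Q t p q" for s t p q
  proof -
    obtain v y where e: "\<psi> \<circ> galilei s v (mat 1) y = galilei s v (mat 1) y \<circ> \<psi>"
      using time by blast
    show ?thesis
      using fun_cong[OF e, of "((t, 0), (0, p, q))"] by (simp add: galilei_apply Z \<psi>)
  qed
  have scale': "T (a * t) (k * p) (k * a\<^sup>2 / b\<^sup>2 * q) = a * T t p q \<and>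
      P (a * t) (k * p) (k * a\<^sup>2 / b\<^sup>2 * q) = k * P t p q \<and>
      Q (a * t) (k * p) (k * a\<^sup>2 / b\<^sup>2 * q) = k * a\<^sup>2 / b\<^sup>2 * Q t p q"
    if pos: "0 < a" "0 < b" "0 < k" for a b k t p q
  proof -
    obtain v y where e: "\<psi> \<circ> similitude a b k 0 v (mat 1) y = similitude a b k 0 v (mat 1) y \<circ> \<psi>"
      using scale[OF pos] by blast
    show ?thesis
      using fun_cong[OF e, of "((t, 0), (0, p, q))"] by (simp add: similitude_apply Z \<psi>)
  qed
  \<comment> \<open>The factors 2, 2, 1 leave the arguments \<open>0\<close>, \<open>p\<close>,
    \<open>q\<close> unchanged but double the value of \<open>T\<close>.\<close>
  have "T 0 p q = 0" for p q
    using scale'[of 2 2 1 0 p q] by simp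
  then have T: "T t p q = t" for t p q
    using time'[of 0 t p q] by simp
  define J :: "real \<times> real \<Rightarrow> phase" where "J z = ((0, 0), (0, z))" for z
  have J: "bounded_linear J"
    unfolding J_def by (intro bounded_linear_Pair bounded_linear_zero bounded_linear_ident)
  have "(\<lambda>z. \<psi> (J z)) differentiable (at 0)"
  proof -
    have "J 0 = 0" by (simp add: J_def zero_prod_def)
    then show ?thesis
      using diff bounded_linear_imp_differentiable[OF J, of "at 0"]
      by (intro differentiable_chain_at[of J 0 \<psi>, unfolded o_def]) auto
  qed
  then obtain D where D: "((\<lambda>z. \<psi> (J z)) has_derivative D) (at 0)"
    by (auto simp: differentiable_def)
  have PJ: "P 0 (fst z) (snd z) = fst (snd (snd (\<psi> (J z))))"
    and QJ: "Q 0 (fst z) (snd z) = snd (snd (snd (\<psi> (J z))))" for z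
    by (simp_all add: P_def Q_def Z_def J_def)
  \<comment> \<open>With \<open>a = b = 1\<close>, pressure and density are multiplied by the same
    positive \<open>k\<close>, which is the homogeneity required.\<close>
  have linP: "linear (\<lambda>z. P 0 (fst z) (snd z))"
  proof (rule homogeneous_differentiable_linear)
    show "(\<lambda>z. P 0 (fst z) (snd z)) differentiable (at 0)"
      unfolding PJ differentiable_def using D
      by (intro exI) (rule has_derivative_fst has_derivative_snd | assumption)+
    show "P 0 (fst (k *\<^sub>R z)) (snd (k *\<^sub>R z)) = k * P 0 (fst z) (snd z)" if "0 < k" for k z
      using scale'[of 1 1 k 0 "fst z" "snd z"] that by simp
  qed
  have linQ: "linear (\<lambda>z. Q 0 (fst z) (snd z))"
  proof (rule homogeneous_differentiable_linear)
    show "(\<lambda>z. Q 0 (fst z) (snd z)) differentiable (at 0)"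
      unfolding QJ differentiable_def using D
      by (intro exI) (rule has_derivative_fst has_derivative_snd | assumption)+
    show "Q 0 (fst (k *\<^sub>R z)) (snd (k *\<^sub>R z)) = k * Q 0 (fst z) (snd z)" if "0 < k" for k z
      using scale'[of 1 1 k 0 "fst z" "snd z"] that by simp
  qed
  \<comment> \<open>Halving lengths at fixed time multiplies density by 4 and keeps pressure;
    together with linearity this excludes mixing of \<open>p\<close> and \<open>q\<close>.\<close>
  have "P 0 0 (4 * 1) = P 0 0 1" "Q 0 1 0 = 4 * Q 0 1 0"
    using scale'[of 1 "1/2" 1 0 0 1] scale'[of 1 "1/2" 1 0 1 0] by (simp_all add: power2_eq_square)
  moreover have "P 0 0 (4 * 1) = 4 * P 0 0 1"
    using linear_cmul[OF linP, of 4 "(0, 1)"] by simp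
  ultimately have z: "P 0 0 1 = 0" "Q 0 1 0 = 0" by simp_all
  have split: "(p, q) = p *\<^sub>R (1, 0) + q *\<^sub>R (0, 1)" for p q :: real by simp
  have P: "P t p q = P 0 1 0 * p" for t p q
  proof -
    have "P t p q = P 0 p q" using time'[of 0 t p q] by simp
    also have "\<dots> = p * P 0 1 0 + q * P 0 0 1"
      using linear_add[OF linP, of "p *\<^sub>R (1, 0)" "q *\<^sub>R (0, 1)"]
        linear_cmul[OF linP, of p "(1, 0)"] linear_cmul[OF linP, of q "(0, 1)"] by simp
    finally show ?thesis using z by simp
  qed
  have Q: "Q t p q = Q 0 0 1 * q" for t p q
  proof -
    have "Q t p q = Q 0 p q" using time'[of 0 t p q] by simp
    also have "\<dots> = p * Q 0 1 0 + q * Q 0 0 1"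
      using linear_add[OF linQ, of "p *\<^sub>R (1, 0)" "q *\<^sub>R (0, 1)"]
        linear_cmul[OF linQ, of p "(1, 0)"] linear_cmul[OF linQ, of q "(0, 1)"] by simp
    finally show ?thesis using z by simp
  qed
  show thesis
    by (rule that[of X0 U0 "P 0 1 0" "Q 0 0 1"], simp add: \<psi> T U X, intro conjI P Q)
qed

text \<open>If \<open>c \<noteq> 1\<close> or \<open>d \<noteq> 1\<close>, then two real parameters describe the fixed points of \<open>\<psi>\<close>, but \<open>\<phi>\<close> embeds
  the three-dimensional space of fixed points of \<open>parity\<close> into them.\<close>

lemma parity_conj_fixed_points:
  fixes \<phi> \<psi> :: "phase \<Rightarrow> phase"
  assumes inj: "inj \<phi>" and cont: "continuous_on UNIV \<phi>"
    and \<psi>: "\<And>t x u p q. \<psi> ((t, x), (u, p, q)) = ((t, X0 + t *\<^sub>R U0 - x), (U0 - u, c * p, d * q))"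
    and comm: "\<psi> \<circ> \<phi> = \<phi> \<circ> parity"
  shows "c = 1" "d = 1"
proof -
  \<comment> \<open>Parity fixes exactly the points with zero position and zero velocity, which
    \<open>w\<close> parametrizes.\<close>
  define w :: "real \<times> real \<times> real \<Rightarrow> phase" where "w z = ((fst z, 0), (0, snd z))" for z
  have fp: "\<psi> (\<phi> (w z)) = \<phi> (w z)" for z
    using fun_cong[OF comm, of "w z"] by (simp add: w_def parity_def case_prod_unfold)
  have comp: "2 *\<^sub>R snd (fst (\<phi> (w z))) = X0 + fst (fst (\<phi> (w z))) *\<^sub>R U0"
    "2 *\<^sub>R fst (snd (\<phi> (w z))) = U0" "c * fst (snd (snd (\<phi> (w z)))) = fst (snd (snd (\<phi> (w z))))"
    "d * snd (snd (snd (\<phi> (w z)))) = snd (snd (snd (\<phi> (w z))))" for z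
  proof -
    obtain t x u p q where m: "\<phi> (w z) = ((t, x), (u, p, q))" by (metis prod.exhaust)
    have dbl: "2 *\<^sub>R y = a" if "a - y = y" for a y :: "real^3"
      using that by (auto simp: diff_eq_eq scaleR_2)
    have "X0 + t *\<^sub>R U0 - x = x" "U0 - u = u" "c * p = p" "d * q = q"
      using fp[of z] unfolding m \<psi> by auto
    note dbl[OF this(1)] dbl[OF this(2)] this(3,4)
    then show "2 *\<^sub>R snd (fst (\<phi> (w z))) = X0 + fst (fst (\<phi> (w z))) *\<^sub>R U0"
      "2 *\<^sub>R fst (snd (\<phi> (w z))) = U0" "c * fst (snd (snd (\<phi> (w z)))) = fst (snd (snd (\<phi> (w z))))"
      "d * snd (snd (snd (\<phi> (w z)))) = snd (snd (snd (\<phi> (w z))))"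
      unfolding m by simp_all
  qed
  have contw: "continuous_on UNIV (\<lambda>z. \<phi> (w z))"
    unfolding w_def by (intro continuous_intros continuous_on_compose2[OF cont]) auto
  \<comment> \<open>At a fixed point of \<psi>, position and velocity are determined by the time
    coordinate, so time, pressure and density separate the image points.\<close>
  have injw: "z = z'"
    if "fst (fst (\<phi> (w z))) = fst (fst (\<phi> (w z')))" "snd (snd (\<phi> (w z))) = snd (snd (\<phi> (w z')))" for z z'
  proof -
    have "2 *\<^sub>R snd (fst (\<phi> (w z))) = 2 *\<^sub>R snd (fst (\<phi> (w z')))"
      "2 *\<^sub>R fst (snd (\<phi> (w z))) = 2 *\<^sub>R fst (snd (\<phi> (w z')))"
      using comp(1,2)[of z] comp(1,2)[of z'] that by simp_all
    then have "\<phi> (w z) = \<phi> (w z')"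
      using that by (simp add: prod_eq_iff)
    then have "w z = w z'" using inj by (simp add: inj_eq)
    then show "z = z'" by (simp add: w_def prod_eq_iff)
  qed
  have *: False if "inj f" "continuous_on UNIV f" for f :: "real \<times> real \<times> real \<Rightarrow> real \<times> real"
    using invariance_of_dimension[OF that(2) open_UNIV] that(1) by simp
  show "c = 1"
  proof (rule ccontr)
    assume "c \<noteq> 1"
    then have "fst (snd (snd (\<phi> (w z)))) = 0" for z using comp(3)[of z] by simp
    then have "inj (\<lambda>z. (fst (fst (\<phi> (w z))), snd (snd (snd (\<phi> (w z))))))"
      by (intro injI injw) (auto simp: prod_eq_iff)
    moreover have "continuous_on UNIV (\<lambda>z. (fst (fst (\<phi> (w z))), snd (snd (snd (\<phi> (w z))))))"
      by (intro continuous_intros contw)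
    ultimately show False by (rule *)
  qed
  show "d = 1"
  proof (rule ccontr)
    assume "d \<noteq> 1"
    then have "snd (snd (snd (\<phi> (w z)))) = 0" for z using comp(4)[of z] by simp
    then have "inj (\<lambda>z. (fst (fst (\<phi> (w z))), fst (snd (snd (\<phi> (w z))))))"
      by (intro injI injw) (auto simp: prod_eq_iff)
    moreover have "continuous_on UNIV (\<lambda>z. (fst (fst (\<phi> (w z))), fst (snd (snd (\<phi> (w z))))))"
      by (intro continuous_intros contw)
    ultimately show False by (rule *)
  qed
qed

context euler_lie_algebra
begin

text \<open>Parity commutes with a similitude free of boost and spatial translation, but the
  pull-back of such a map by \<phi> may contain both. They are split off as a right factor, whose
  \<phi>-conjugate is again a boost with translation by \<open>conj_boost\<close>. Hence commutation
  is obtained only for a version of the given similitude modified by some \<open>v\<close> and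
  \<open>y\<close>.\<close>

lemma parity_conj_commute:
  assumes \<phi>: "\<phi> \<in> carrier (symmetry_group \<gamma>)"
    and h: "normal_similitude (similitude a b k s 0 R 0)" "0 < a" "0 < b" "0 < k"
  shows "\<exists>v y. conj_by \<phi> parity \<circ> similitude a b k s v R y = similitude a b k s v R y \<circ> conj_by \<phi> parity"
proof -
  let ?h = "similitude a b k s 0 R 0"
  have bij: "bij \<phi>" using \<phi> by (rule symmetry_group_bij)
  have "inverse_map \<phi> \<in> carrier (symmetry_group \<gamma>)" using \<phi> by (rule symmetry_group_inverse)
  with h(1) obtain a' b' k' s' v' R' y' where
    g: "conj_by (inverse_map \<phi>) ?h = similitude a' b' k' s' v' R' y'" and
    pos: "0 < a'" "0 < b'" "0 < k'" and ort: "orthogonal_matrix R'"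
    by (rule normal_similitude_conj)
  let ?h' = "similitude a' b' k' s' 0 R' 0"
  \<comment> \<open>These solve \<open>b' *\<^sub>R (R' *v v1) = v'\<close>, and likewise for
    \<open>y'\<close>; multiplication from the left applies the transpose of
    \<open>R'\<close>.\<close>
  define v1 y1 where "v1 = (1 / b') *\<^sub>R (v' v* R')" and "y1 = (1 / b') *\<^sub>R (y' v* R')"
  obtain v2 y2 where b2: "conj_by \<phi> (galilei 0 (- v1) (mat 1) (- y1)) = galilei 0 v2 (mat 1) y2"
    using \<phi> by (rule conj_boost)
  have RR: "R' *v (w v* R') = w" for w
    using ort unfolding transpose_matrix_vector[symmetric] matrix_vector_mul_assoc
    by (simp add: orthogonal_matrix_def)
  have "similitude a' b' k' s' v' R' y' = ?h' \<circ> galilei 0 v1 (mat 1) y1"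
    using pos by (simp add: galilei_def similitude_comp v1_def y1_def matrix_vector_mult_scaleR RR)
  then have "similitude a' b' k' s' v' R' y' \<circ> galilei 0 (- v1) (mat 1) (- y1)
      = ?h' \<circ> (galilei 0 v1 (mat 1) y1 \<circ> galilei 0 (- v1) (mat 1) (- y1))"
    by (simp only: comp_assoc)
  then have "?h' = conj_by (inverse_map \<phi>) ?h \<circ> galilei 0 (- v1) (mat 1) (- y1)"
    by (simp add: g galilei_comp galilei_id)
  then have "conj_by \<phi> ?h' = ?h \<circ> galilei 0 v2 (mat 1) y2"
    by (simp add: conj_by_comp[OF bij, symmetric] conj_by_inverse[OF bij] b2)
  then have h': "conj_by \<phi> ?h' = similitude a b k s (b *\<^sub>R (R *v v2)) R (b *\<^sub>R (R *v y2))"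
    using h by (simp add: galilei_def similitude_comp)
  have "parity \<circ> ?h' = ?h' \<circ> parity"
    by (auto simp: fun_eq_iff parity_def similitude_apply matrix_vector_minus)
  then have "conj_by \<phi> parity \<circ> conj_by \<phi> ?h' = conj_by \<phi> ?h' \<circ> conj_by \<phi> parity"
    by (simp add: conj_by_comp[OF bij])
  then show ?thesis unfolding h' by blast
qed

lemma conj_parity:
  assumes \<phi>: "\<phi> \<in> carrier (symmetry_group \<gamma>)"
  shows "conj_by \<phi> parity \<in> galilean_transformations"
proof -
  let ?\<psi> = "conj_by \<phi> parity"
  have bij: "bij \<phi>" using \<phi> by (rule symmetry_group_bij)
  \<comment> \<open>By \<open>conj_boost\<close> for the inverse of \<phi>, every boost is the
    \<phi>-conjugate of a boost, so the relation of parity with boosts can be transported to all of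
    them.\<close>
  have boost: "?\<psi> \<circ> galilei 0 v (mat 1) y = galilei 0 (- v) (mat 1) (- y) \<circ> ?\<psi>" for v y
  proof -
    let ?g = "galilei 0 v (mat 1) y" and ?g' = "galilei 0 (- v) (mat 1) (- y)"
    have "inverse_map \<phi> \<in> carrier (symmetry_group \<gamma>)" using \<phi> by (rule symmetry_group_inverse)
    then obtain v1 y1 where g: "conj_by (inverse_map \<phi>) ?g = galilei 0 v1 (mat 1) y1"
      by (rule conj_boost)
    let ?h = "galilei 0 v1 (mat 1) y1" and ?h' = "galilei 0 (- v1) (mat 1) (- y1)"
    have h: "conj_by \<phi> ?h = ?g" using conj_by_inverse[OF bij, of ?g] by (simp add: g)
    have "?g \<circ> conj_by \<phi> ?h' = id"
      unfolding h[symmetric] conj_by_comp[OF bij] by (simp add: galilei_comp galilei_id conj_by_id[OF bij])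
    then have "?g' \<circ> (?g \<circ> conj_by \<phi> ?h') = ?g'" by simp
    then have h': "conj_by \<phi> ?h' = ?g'"
      unfolding comp_assoc[symmetric] galilei_comp by (simp add: galilei_id)
    have "parity \<circ> ?h = ?h' \<circ> parity"
      by (auto simp: fun_eq_iff parity_def galilei_apply)
    then have "?\<psi> \<circ> conj_by \<phi> ?h = conj_by \<phi> ?h' \<circ> ?\<psi>"
      by (simp add: conj_by_comp[OF bij])
    then show ?thesis by (simp add: h h')
  qed
  have "?\<psi> \<in> carrier (symmetry_group \<gamma>)"
    unfolding conj_by_def by (intro symmetry_group_comp symmetry_group_inverse \<phi> parity_symmetry)
  then have sm: "smooth_on UNIV \<phi>" "smooth_on UNIV ?\<psi>"
    using \<phi> by (auto intro: diffeomorphism_smooth(1) symmetry_group_diffeomorphism)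
  have diff: "?\<psi> differentiable (at 0)"
    by (rule smooth_on_differentiable[OF open_UNIV sm(2)]) simp
  obtain U0 X0 c d where \<psi>:
    "\<And>t x u p q. ?\<psi> ((t, x), (u, p, q)) = ((t, X0 + t *\<^sub>R U0 - x), (U0 - u, c * p, d * q))"
  proof (rule boost_inverting_map[of ?\<psi>])
    show "\<exists>v y. ?\<psi> \<circ> galilei s v (mat 1) y = galilei s v (mat 1) y \<circ> ?\<psi>" for s
      using parity_conj_commute[OF \<phi>, of 1 1 1 s "mat 1"] time_normal_similitude
      by (simp add: galilei_def)
    show "\<exists>v y. ?\<psi> \<circ> similitude a b k 0 v (mat 1) y = similitude a b k 0 v (mat 1) y \<circ> ?\<psi>"
      if "0 < a" "0 < b" "0 < k" for a b k
      using that by (intro parity_conj_commute[OF \<phi>] scaling_normal_similitude)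
    show "\<exists>v y. ?\<psi> \<circ> galilei 0 v (half_turn n) y = galilei 0 v (half_turn n) y \<circ> ?\<psi>"
      if "norm n = 1" for n
      using parity_conj_commute[OF \<phi>, of 1 1 1 0 "half_turn n"] half_turn_normal_similitude[OF that]
      by (simp add: galilei_def)
  qed (use boost diff in blast)+
  have cont: "continuous_on UNIV \<phi>"
    using smooth_on_differentiable[OF open_UNIV sm(1)]
    by (intro continuous_at_imp_continuous_on) (auto intro: differentiable_imp_continuous_within)
  have comm: "?\<psi> \<circ> \<phi> = \<phi> \<circ> parity"
    by (auto simp: conj_by_def inverse_map_comp[OF bij])
  have "c = 1" "d = 1"
    using parity_conj_fixed_points[OF bij_is_inj[OF bij] cont \<psi> comm] by auto
  then have "?\<psi> = galilei 0 U0 (- mat 1) X0"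
    by (auto simp: \<psi> galilei_apply matrix_uminus_vector)
  moreover have "orthogonal_matrix (- mat 1 :: real^3^3)"
    by (rule orthogonal_matrix_uminus_mat)
  ultimately show ?thesis unfolding galilean_transformations_def by blast
qed

end

section \<open>Normality\<close>

text \<open>The argument of Cartan and Dieudonne: reflections are negatives of half turns, and each
  step uses one of them to move the image of a further basis vector back into place. The matrix left
  at the end fixes the basis.\<close>

lemma orthogonal_matrix_induct [consumes 1, case_names uminus half_turn mult]:
  fixes R :: "real^3^3"
  assumes "orthogonal_matrix R"
    and neg: "P (- mat 1)" and half: "\<And>n. norm n = 1 \<Longrightarrow> P (half_turn n)"
    and mult: "\<And>A B. P A \<Longrightarrow> P B \<Longrightarrow> P (A ** B)"
  shows "P R"
proof -
  have one: "P (mat 1)"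
  proof -
    have "(- mat 1) ** (- mat 1) = (mat 1 :: real^3^3)"
      by (simp add: matrix_eq matrix_vector_mul_assoc[symmetric] matrix_uminus_vector)
    then show ?thesis using mult[OF neg neg] by simp
  qed
  \<comment> \<open>For \<open>a \<noteq> b\<close> this is the reflection exchanging them; the
    condition \<open>x \<bullet> a = x \<bullet> b\<close> says that \<open>x\<close> lies on the
    mirror.\<close>
  have reflect: "\<exists>A. P A \<and> orthogonal_matrix A \<and> A ** A = mat 1 \<and> A *v a = b \<and>
      (\<forall>x. x \<bullet> a = x \<bullet> b \<longrightarrow> A *v x = x)"
    if ab: "norm a = norm b" for a b :: "real^3"
  proof (cases "a = b")
    case True
    then show ?thesis using one by (intro exI[of _ "mat 1"]) (simp add: orthogonal_matrix_id)
  next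
    case False
    define n where "n = (a - b) /\<^sub>R norm (a - b)"
    define A where "A = (- mat 1) ** half_turn n"
    have n: "norm n = 1" using False by (simp add: n_def)
    have A: "A *v x = x - (2 * (n \<bullet> x)) *\<^sub>R n" for x
      by (simp add: A_def matrix_vector_mul_assoc[symmetric] matrix_uminus_vector half_turn_apply)
    have "A ** A = mat 1"
      using n by (simp add: matrix_eq matrix_vector_mul_assoc[symmetric] A inner_diff_right norm_eq_1
          vec_eq_iff field_simps)
    moreover have "A *v x = x" if "x \<bullet> a = x \<bullet> b" for x
    proof -
      have "n \<bullet> x = 0"
        using that by (simp add: n_def inner_diff_left inner_commute[of a x] inner_commute[of b x])
      then show ?thesis by (simp add: A)
    qed
    moreover have "A *v a = b"
    proof -
      have e: "2 * ((a - b) \<bullet> a) = (norm (a - b))\<^sup>2"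
        using ab by (simp add: power2_norm_eq_inner norm_eq inner_diff_left inner_diff_right inner_commute)
      have "2 * (n \<bullet> a) = 2 * ((a - b) \<bullet> a) / norm (a - b)"
        by (simp add: n_def divide_inverse mult.commute)
      also have "\<dots> = norm (a - b)"
        unfolding e by (simp add: power2_eq_square)
      finally have "2 * (n \<bullet> a) = norm (a - b)" .
      then show ?thesis using False by (simp add: A n_def)
    qed
    moreover have "P A" unfolding A_def by (intro mult neg half n)
    moreover have "orthogonal_matrix A"
      unfolding A_def by (intro orthogonal_matrix_mul half_turn_orthogonal n orthogonal_matrix_uminus_mat)
    ultimately show ?thesis by blast
  qed
  \<comment> \<open>The property travels backwards: \<open>P\<close> is only assumed for the
    partially corrected matrix \<open>R'\<close>, and each reflection is undone by applying it once
    more.\<close>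
  have "\<exists>R'. orthogonal_matrix R' \<and> (\<forall>i\<in>S. R' *v axis i 1 = axis i 1) \<and> (P R' \<longrightarrow> P R)" for S :: "3 set"
  proof (induction S rule: infinite_finite_induct)
    case (insert i S)
    then obtain R' where R': "orthogonal_matrix R'" "\<And>j. j \<in> S \<Longrightarrow> R' *v axis j 1 = axis j 1" "P R' \<Longrightarrow> P R"
      by blast
    have "norm (R' *v axis i 1) = norm (axis i 1 :: real^3)"
      using R'(1) by (rule orthogonal_matrix_norm)
    from reflect[OF this] obtain A where A: "P A" "orthogonal_matrix A" "A ** A = mat 1"
      "A *v (R' *v axis i 1) = axis i 1" "\<And>x. x \<bullet> (R' *v axis i 1) = x \<bullet> axis i 1 \<Longrightarrow> A *v x = x"
      by blast
    have ort: "orthogonal_transformation ((*v) R')"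
      using R'(1) by (simp add: orthogonal_transformation_matrix)
    have "(A ** R') *v axis j 1 = axis j 1" if "j \<in> S" for j
    proof -
      \<comment> \<open>As \<open>R'\<close> preserves inner products and already fixes
        \<open>axis j 1\<close>, this vector lies on the mirror of the new reflection.\<close>
      have "(R' *v axis j 1) \<bullet> (R' *v axis i 1) = axis j 1 \<bullet> (axis i 1 :: real^3)"
        using ort unfolding orthogonal_transformation_def by blast
      then have "A *v axis j 1 = axis j 1"
        using R'(2)[OF that] by (intro A(5)) simp
      then show ?thesis using R'(2)[OF that] by (simp add: matrix_vector_mul_assoc[symmetric])
    qed
    moreover have "(A ** R') *v axis i 1 = axis i 1"
      using A(4) by (simp add: matrix_vector_mul_assoc)
    moreover have "P R" if "P (A ** R')"
    proof (rule R'(3))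
      have "A ** (A ** R') = R'" by (simp add: matrix_mul_assoc A(3))
      then show "P R'" using mult[OF A(1) that] by simp
    qed
    moreover have "orthogonal_matrix (A ** R')" using A(2) R'(1) by (rule orthogonal_matrix_mul)
    ultimately show ?case by (intro exI[of _ "A ** R'"]) auto
  qed (use assms(1) in auto)
  from this[of UNIV] obtain R' where R': "\<And>i. R' *v axis i 1 = axis i 1" "P R' \<Longrightarrow> P R" by auto
  have "R' = mat 1"
  proof -
    have "R' $ i $ j = mat 1 $ i $ j" for i j
    proof -
      have "R' $ i $ j = axis j 1 $ i"
        using arg_cong[OF R'(1)[of j], of "\<lambda>x. x $ i"]
        by (simp add: matrix_vector_mul_component inner_axis)
      then show ?thesis by (simp add: mat_def axis_def)
    qed
    then show ?thesis by (simp add: vec_eq_iff)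
  qed
  then show ?thesis using R'(2) one by simp
qed

section \<open>Factors and inverses of Galilean transformations\<close>

lemma galilei_factor:
  "galilei s v R y = galilei 0 v (mat 1) (y - s *\<^sub>R v) \<circ> (galilei s 0 (mat 1) 0 \<circ> galilei 0 0 R 0)"
  by (simp add: galilei_comp)

lemma galilei_inverse:
  assumes "orthogonal_matrix R"
  shows "inverse_map (galilei s v R y) =
    galilei (- s) (- (v v* R)) (transpose R) (s *\<^sub>R (v v* R) - y v* R)"
proof (rule inv_unique_comp)
  have "R *v (w v* R) = w" for w
    using assms unfolding transpose_matrix_vector[symmetric] matrix_vector_mul_assoc
    by (simp add: orthogonal_matrix_def)
  then show "galilei s v R y \<circ> galilei (- s) (- (v v* R)) (transpose R) (s *\<^sub>R (v v* R) - y v* R) = id"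
    using assms by (simp add: galilei_comp orthogonal_matrix_def matrix_vector_minus galilei_id
        matrix_vector_mult_diff_distrib matrix_vector_mult_scaleR)
  show "galilei (- s) (- (v v* R)) (transpose R) (s *\<^sub>R (v v* R) - y v* R) \<circ> galilei s v R y = id"
    using assms by (simp add: galilei_comp orthogonal_matrix_def galilei_id)
qed

context euler_lie_algebra
begin

text \<open>Both claims pass to products, so they are checked on generators only; parity accounts
  for the matrices of determinant -1.\<close>

lemma rotation_conj:
  assumes "orthogonal_matrix R"
  shows "galilei 0 0 R 0 \<in> carrier (symmetry_group \<gamma>) \<and>
    (\<forall>\<phi>\<in>carrier (symmetry_group \<gamma>). conj_by \<phi> (galilei 0 0 R 0) \<in> galilean_transformations)"
  using assms
proof (induction R rule: orthogonal_matrix_induct)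
  case uminus
  then show ?case using parity_symmetry conj_parity by (simp add: parity_galilei)
next
  case (half_turn n)
  have "conj_by \<phi> (galilei 0 0 (half_turn n) 0) \<in> galilean_transformations"
    if \<phi>: "\<phi> \<in> carrier (symmetry_group \<gamma>)" for \<phi>
    using \<phi> half_turn
  proof (rule conj_half_turn_galilei)
    show ?thesis
      if "conj_by \<phi> (galilei 0 0 (half_turn n) 0) = galilei s v R y" "orthogonal_matrix R" for s v R y
      using that unfolding galilean_transformations_def by blast
  qed
  then show ?case
    using half_turn_normal_similitude[OF half_turn] by (simp add: normal_similitude_def)
next
  case (mult A B)
  have AB: "galilei 0 0 (A ** B) 0 = galilei 0 0 A 0 \<circ> galilei 0 0 B 0"
    by (simp add: galilei_comp)
  show ?case
  proof (intro conjI ballI)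
    show "galilei 0 0 (A ** B) 0 \<in> carrier (symmetry_group \<gamma>)"
      unfolding AB using mult.IH by (intro symmetry_group_comp) blast+
    show "conj_by \<phi> (galilei 0 0 (A ** B) 0) \<in> galilean_transformations"
      if "\<phi> \<in> carrier (symmetry_group \<gamma>)" for \<phi>
      unfolding AB conj_by_comp[OF symmetry_group_bij[OF that], symmetric]
      using mult.IH that by (intro galilean_transformations_comp) blast+
  qed
qed

lemma galilean_transformations_conj:
  assumes g: "g \<in> galilean_transformations"
  shows "g \<in> carrier (symmetry_group \<gamma>)"
    and "\<phi> \<in> carrier (symmetry_group \<gamma>) \<Longrightarrow> conj_by \<phi> g \<in> galilean_transformations"
proof -
  obtain s v R y where g: "g = galilei s v R y" and R: "orthogonal_matrix R"
    using g by (auto simp: galilean_transformations_def)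
  show "g \<in> carrier (symmetry_group \<gamma>)"
    unfolding g galilei_factor[of s v R y]
    using rotation_conj[OF R] boost_normal_similitude time_normal_similitude
    by (intro symmetry_group_comp) (auto simp: normal_similitude_def)
  show "conj_by \<phi> g \<in> galilean_transformations" if \<phi>: "\<phi> \<in> carrier (symmetry_group \<gamma>)"
  proof -
    obtain v1 y1 where "conj_by \<phi> (galilei 0 v (mat 1) (y - s *\<^sub>R v)) = galilei 0 v1 (mat 1) y1"
      using \<phi> by (rule conj_boost)
    moreover obtain s2 v2 y2 where "conj_by \<phi> (galilei s 0 (mat 1) 0) = galilei s2 v2 (mat 1) y2"
      using \<phi> by (rule conj_time_galilei)
    moreover have "galilei s v (mat 1) y \<in> galilean_transformations" for s v y
      using orthogonal_matrix_id unfolding galilean_transformations_def by blast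
    ultimately have "conj_by \<phi> (galilei 0 v (mat 1) (y - s *\<^sub>R v)) \<in> galilean_transformations"
      "conj_by \<phi> (galilei s 0 (mat 1) 0) \<in> galilean_transformations"
      by simp_all
    then show ?thesis
      unfolding g galilei_factor[of s v R y] conj_by_comp[OF symmetry_group_bij[OF \<phi>], symmetric]
      using rotation_conj[OF R] \<phi> by (intro galilean_transformations_comp) auto
  qed
qed

lemma galilean_transformations_normal: "galilean_transformations \<lhd> symmetry_group \<gamma>"
proof (rule group.normal_invI[OF symmetry_group_group])
  show "subgroup galilean_transformations (symmetry_group \<gamma>)"
  proof (rule group.subgroupI[OF symmetry_group_group])
    show "galilean_transformations \<noteq> {}"
      using orthogonal_matrix_id unfolding galilean_transformations_def by blast
    show "m_inv (symmetry_group \<gamma>) g \<in> galilean_transformations" if g: "g \<in> galilean_transformations" for g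
    proof -
      obtain s v R y where "g = galilei s v R y" and R: "orthogonal_matrix R"
        using g by (auto simp: galilean_transformations_def)
      then have "inverse_map g = galilei (- s) (- (v v* R)) (transpose R) (s *\<^sub>R (v v* R) - y v* R)"
        using galilei_inverse by simp
      moreover have "orthogonal_matrix (transpose R)" using R by simp
      ultimately show ?thesis
        unfolding symmetry_group_m_inv[OF galilean_transformations_conj(1)[OF g]]
          galilean_transformations_def by blast
    qed
    show "galilean_transformations \<subseteq> carrier (symmetry_group \<gamma>)"
      by (rule subsetI) (rule galilean_transformations_conj(1))
    show "g \<otimes>\<^bsub>symmetry_group \<gamma>\<^esub> h \<in> galilean_transformations"
      if "g \<in> galilean_transformations" "h \<in> galilean_transformations" for g h
      unfolding symmetry_group_simps using that by (rule galilean_transformations_comp)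
  qed
  show "\<phi> \<otimes>\<^bsub>symmetry_group \<gamma>\<^esub> g \<otimes>\<^bsub>symmetry_group \<gamma>\<^esub> m_inv (symmetry_group \<gamma>) \<phi> \<in> galilean_transformations"
    if "\<phi> \<in> carrier (symmetry_group \<gamma>)" "g \<in> galilean_transformations" for \<phi> g
    using galilean_transformations_conj(2)[OF that(2,1)] symmetry_group_m_inv[OF that(1)]
    by (simp add: conj_by_def)
qed

end

section \<open>The isomorphism with the Galilean group\<close>

lemma exhaust_5:
  fixes x :: 5
  shows "x = 1 \<or> x = 2 \<or> x = 3 \<or> x = 4 \<or> x = 5"
proof (induct x)
  case (of_int z)
  then have "z = 0 \<or> z = 1 \<or> z = 2 \<or> z = 3 \<or> z = 4" by fastforce
  then show ?case by auto
qed

lemma forall_5: "(\<forall>i::5. P i) \<longleftrightarrow> P 1 \<and> P 2 \<and> P 3 \<and> P 4 \<and> P 5"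
  by (metis exhaust_5)

lemma UNIV_5: "UNIV = {1, 2, 3, 4, 5::5}"
  using exhaust_5 by auto

lemma sum_5: "sum f (UNIV::5 set) = f 1 + f 2 + f 3 + f 4 + f 5"
  unfolding UNIV_5 by (simp add: ac_simps)

lemma vector_5 [simp]:
  "(vector [a, b, c, d, e] :: ('a::zero)^5) $ 1 = a"
  "(vector [a, b, c, d, e] :: ('a::zero)^5) $ 2 = b"
  "(vector [a, b, c, d, e] :: ('a::zero)^5) $ 3 = c"
  "(vector [a, b, c, d, e] :: ('a::zero)^5) $ 4 = d"
  "(vector [a, b, c, d, e] :: ('a::zero)^5) $ 5 = e"
  by (simp_all add: vector_def)

definition matrix_velocity :: "real^5^5 \<Rightarrow> real^3" where
  "matrix_velocity A = vector [A $ 2 $ 1, A $ 3 $ 1, A $ 4 $ 1]"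

definition matrix_rotation :: "real^5^5 \<Rightarrow> real^3^3" where
  "matrix_rotation A = vector [vector [A $ 2 $ 2, A $ 2 $ 3, A $ 2 $ 4],
     vector [A $ 3 $ 2, A $ 3 $ 3, A $ 3 $ 4], vector [A $ 4 $ 2, A $ 4 $ 3, A $ 4 $ 4]]"

definition matrix_translation :: "real^5^5 \<Rightarrow> real^3" where
  "matrix_translation A = vector [A $ 2 $ 5, A $ 3 $ 5, A $ 4 $ 5]"

text \<open>Reading the parameters off the entries defines the action for all matrices, not only
  Galilean ones. This supplies a smooth extension to the whole matrix space.\<close>

definition galilean_action :: "real^5^5 \<Rightarrow> phase \<Rightarrow> phase" where
  "galilean_action A = galilei (A $ 1 $ 5) (matrix_velocity A) (matrix_rotation A) (matrix_translation A)"

lemma galilean_action_matrix: "galilean_action (galilean_matrix s v R y) = galilei s v R y"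
proof -
  have "matrix_velocity (galilean_matrix s v R y) = v" "matrix_rotation (galilean_matrix s v R y) = R"
    "matrix_translation (galilean_matrix s v R y) = y" "galilean_matrix s v R y $ 1 $ 5 = s"
    by (simp_all add: matrix_velocity_def matrix_rotation_def matrix_translation_def
        galilean_matrix_def vec_eq_iff forall_3)
  then show ?thesis by (simp add: galilean_action_def)
qed

text \<open>The parameters combine as in \<open>galilei_comp\<close>, which makes the action a
  homomorphism.\<close>

lemma galilean_matrix_mult:
  "galilean_matrix s v R y ** galilean_matrix s' v' R' y' =
    galilean_matrix (s + s') (R *v v' + v) (R ** R') (R *v y' + s' *\<^sub>R v + y)"
  by (simp add: galilean_matrix_def vec_eq_iff forall_5 matrix_matrix_mult_def matrix_vector_mult_def
      sum_5 sum_3 algebra_simps)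

lemma homogeneous_galilei:
  "homogeneous (fst (galilei s v R y m)) = galilean_matrix s v R y *v homogeneous (fst m)"
proof -
  obtain t x u p q where m: "m = ((t, x), (u, p, q))" by (metis prod.exhaust)
  show ?thesis
    by (simp add: m galilei_apply homogeneous_def galilean_matrix_def vec_eq_iff forall_5
        matrix_vector_mult_def sum_5 sum_3 algebra_simps)
qed

lemma galilean_action_iso:
  "galilean_action \<in> iso galilean_group (symmetry_group \<gamma>\<lparr>carrier := galilean_transformations\<rparr>)"
proof -
  have "galilean_action (A ** B) = galilean_action A \<circ> galilean_action B"
    if "A \<in> carrier galilean_group" "B \<in> carrier galilean_group" for A B
    using that by (auto simp: galilean_group_def galilean_matrix_mult galilean_action_matrix galilei_comp)
  moreover have "bij_betw galilean_action (carrier galilean_group) galilean_transformations"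
  proof (rule bij_betw_imageI)
    show "inj_on galilean_action (carrier galilean_group)"
    proof (rule inj_onI)
      fix A B
      assume AB: "A \<in> carrier galilean_group" "B \<in> carrier galilean_group"
        and eq: "galilean_action A = galilean_action B"
      obtain s v R y where A: "A = galilean_matrix s v R y" and R: "orthogonal_matrix R"
        using AB(1) by (auto simp: galilean_group_def)
      obtain s' v' R' y' where B: "B = galilean_matrix s' v' R' y'" and R': "orthogonal_matrix R'"
        using AB(2) by (auto simp: galilean_group_def)
      from galilei_inject[OF eq[unfolded A B galilean_action_matrix] R R']
      show "A = B" by (simp add: A B)
    qed
    show "galilean_action ` carrier galilean_group = galilean_transformations"
    proof (intro equalityI subsetI)
      fix g assume "g \<in> galilean_action ` carrier galilean_group"
      then show "g \<in> galilean_transformations"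
        unfolding galilean_transformations_def galilean_group_def
        using galilean_action_matrix by fastforce
    next
      fix g assume "g \<in> galilean_transformations"
      then obtain s v R y where g: "g = galilei s v R y" and "orthogonal_matrix R"
        by (auto simp: galilean_transformations_def)
      then have "galilean_matrix s v R y \<in> carrier galilean_group"
        by (auto simp: galilean_group_def)
      then show "g \<in> galilean_action ` carrier galilean_group"
        unfolding g galilean_action_matrix[symmetric] by (rule imageI)
    qed
  qed
  moreover have "mult galilean_group = (**)" by (simp add: galilean_group_def)
  ultimately show ?thesis
    by (intro isoI homI) (auto dest: bij_betwE)
qed

section \<open>Smoothness of the action and of its inverse\<close>

lemma smooth_on_entry:
  assumes "bounded_linear L"
  shows "smooth_on UNIV (\<lambda>z :: 'a::euclidean_space. (L z :: real^5^5) $ i $ j)"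
  by (intro bounded_linear_smooth_on open_UNIV
      bounded_linear_compose[OF bounded_linear_vec_nth bounded_linear_compose[OF bounded_linear_vec_nth assms]])

lemma smooth_on_vector_3:
  assumes "smooth_on UNIV f" "smooth_on UNIV g" "smooth_on UNIV h"
  shows "smooth_on UNIV (\<lambda>x. vector [f x, g x, h x] :: ('b::euclidean_space)^3)"
proof (rule smooth_on_vec[OF open_UNIV])
  fix i :: 3
  show "smooth_on UNIV (\<lambda>x. (vector [f x, g x, h x] :: 'b^3) $ i)"
    using exhaust_3[of i] assms by auto
qed

lemma bounded_bilinear_matrix_vector: "bounded_bilinear ((*v) :: real^'n^'m \<Rightarrow> real^'n \<Rightarrow> real^'m)"
  unfolding bilinear_conv_bounded_bilinear[symmetric] bilinear_def
  by (auto intro!: linearI simp: matrix_vector_mult_add_rdistrib matrix_vector_right_distrib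
      matrix_vector_mult_scaleR scaleR_matrix_vector_assoc)

lemma galilean_action_smooth: "smooth_on UNIV (\<lambda>(A, m). galilean_action A m)"
proof -
  have A: "smooth_on UNIV (\<lambda>z :: (real^5^5) \<times> phase. fst z $ i $ j)" for i j
    by (rule smooth_on_entry[OF bounded_linear_fst])
  have v: "smooth_on UNIV (\<lambda>z :: (real^5^5) \<times> phase. matrix_velocity (fst z))"
    and y: "smooth_on UNIV (\<lambda>z :: (real^5^5) \<times> phase. matrix_translation (fst z))"
    and R: "smooth_on UNIV (\<lambda>z :: (real^5^5) \<times> phase. matrix_rotation (fst z))"
    unfolding matrix_velocity_def matrix_translation_def matrix_rotation_def
    by (intro smooth_on_vector_3 A)+
  have m: "smooth_on UNIV (\<lambda>z :: (real^5^5) \<times> phase. fst (fst (snd z)))"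
    "smooth_on UNIV (\<lambda>z :: (real^5^5) \<times> phase. snd (fst (snd z)))"
    "smooth_on UNIV (\<lambda>z :: (real^5^5) \<times> phase. fst (snd (snd z)))"
    "smooth_on UNIV (\<lambda>z :: (real^5^5) \<times> phase. snd (snd (snd z)))"
    by (intro bounded_linear_smooth_on open_UNIV bounded_linear_compose[OF bounded_linear_fst]
        bounded_linear_compose[OF bounded_linear_snd] bounded_linear_fst bounded_linear_snd)+
  have "smooth_on UNIV (\<lambda>z :: (real^5^5) \<times> phase.
     ((fst (fst (snd z)) + fst z $ 1 $ 5,
       matrix_rotation (fst z) *v snd (fst (snd z)) + fst (fst (snd z)) *\<^sub>R matrix_velocity (fst z)
         + matrix_translation (fst z)),
      (matrix_rotation (fst z) *v fst (snd (snd z)) + matrix_velocity (fst z), snd (snd (snd z)))))"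
    by (intro smooth_on_Pair smooth_on_add open_UNIV A v y m
        smooth_on_bilinear[OF open_UNIV bounded_bilinear_matrix_vector R]
        smooth_on_bilinear[OF open_UNIV bounded_bilinear_scaleR])
  also have "(\<lambda>z :: (real^5^5) \<times> phase.
     ((fst (fst (snd z)) + fst z $ 1 $ 5,
       matrix_rotation (fst z) *v snd (fst (snd z)) + fst (fst (snd z)) *\<^sub>R matrix_velocity (fst z)
         + matrix_translation (fst z)),
      (matrix_rotation (fst z) *v fst (snd (snd z)) + matrix_velocity (fst z), snd (snd (snd z)))))
    = (\<lambda>(A, m). galilean_action A m)"
    by (auto simp: galilean_action_def galilei_apply)
  finally show ?thesis .
qed

text \<open>Finitely many test points recover the matrix: the origin yields time shift, velocity and
  translation, and the points with velocity \<open>axis j 1\<close> yield the columns of the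
  rotation after subtracting \<open>v\<close>. The image of each test point is smooth in the curve
  parameter.\<close>

lemma galilean_action_smooth_inverse:
  assumes c: "\<And>s. c s \<in> carrier galilean_group" and sm: "smooth_curve (\<lambda>s. galilean_action (c s))"
  shows "smooth_on UNIV c"
proof -
  have S: "smooth_on UNIV (\<lambda>s. galilean_action (c s) m)" for m
  proof -
    have "smooth_on UNIV (\<lambda>s. (\<lambda>(s, m). galilean_action (c s) m) (s, m))"
      by (rule smooth_on_compose[OF open_UNIV open_UNIV sm[unfolded smooth_curve_def]])
        (simp_all add: smooth_on_Pair smooth_on_const bounded_linear_smooth_on bounded_linear_ident)
    then show ?thesis by simp
  qed
  define z :: phase where "z = ((0, 0), (0, 0, 0))"
  define \<sigma> where "\<sigma> s = fst (fst (galilean_action (c s) z))" for s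
  define y where "y s = snd (fst (galilean_action (c s) z))" for s
  define v where "v s = fst (snd (galilean_action (c s) z))" for s
  define w where "w j s = fst (snd (galilean_action (c s) ((0, 0), (axis j 1, 0, 0))))" for j s
  define R where "R s = (\<chi> i j. w j s $ i - v s $ i)" for s
  have cs: "c s = galilean_matrix (\<sigma> s) (v s) (R s) (y s)" for s
  proof -
    obtain \<sigma>' v' R' y' where e: "c s = galilean_matrix \<sigma>' v' R' y'"
      using c[of s] by (auto simp: galilean_group_def)
    have "R s = R'"
      by (simp add: vec_eq_iff R_def w_def v_def z_def e galilean_action_matrix galilei_apply
          matrix_vector_mul_component inner_axis)
    moreover have "\<sigma> s = \<sigma>'" "v s = v'" "y s = y'"
      by (simp_all add: \<sigma>_def v_def y_def z_def e galilean_action_matrix galilei_apply)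
    ultimately show ?thesis by (simp add: e)
  qed
  have sm1: "smooth_on UNIV \<sigma>" "smooth_on UNIV (\<lambda>s. v s $ i)" "smooth_on UNIV (\<lambda>s. y s $ i)"
    "smooth_on UNIV (\<lambda>s. w j s $ i)" for i j
    unfolding \<sigma>_def v_def y_def w_def
    by (rule smooth_on_linear_compose[OF open_UNIV _ S];
        intro bounded_linear_compose[OF bounded_linear_vec_nth] bounded_linear_compose[OF bounded_linear_fst]
          bounded_linear_compose[OF bounded_linear_snd] bounded_linear_fst bounded_linear_snd)+
  have "smooth_on UNIV (\<lambda>s. w j s $ i + - (v s $ i))" for i j
    by (intro smooth_on_add open_UNIV sm1
        smooth_on_linear_compose[OF open_UNIV bounded_linear_minus[OF bounded_linear_ident]])
  then have sm2: "smooth_on UNIV (\<lambda>s. R s $ i $ j)" for i j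
    by (simp add: R_def)
  show ?thesis
  proof (intro smooth_on_vec open_UNIV)
    fix i j :: 5
    show "smooth_on UNIV (\<lambda>s. c s $ i $ j)"
      unfolding cs galilean_matrix_def
      using exhaust_5[of i] exhaust_5[of j]
      by (elim disjE) (simp_all add: sm1 sm2 smooth_on_const)
  qed
qed

theorem theorem5:
  fixes \<gamma> :: real
  assumes "lie_algebra (symmetry_group \<gamma>) = euler_fields_span"
  shows "\<exists>N \<Theta>. N \<lhd> symmetry_group \<gamma> \<and>
           lie_group_iso galilean_group (symmetry_group \<gamma>\<lparr>carrier := N\<rparr>) \<Theta> \<and>
           (\<forall>A\<in>carrier galilean_group. \<forall>m. homogeneous (fst (\<Theta> A m)) = A *v homogeneous (fst m))"
proof (intro exI conjI)
  show "galilean_transformations \<lhd> symmetry_group \<gamma>"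
    using assms by (intro euler_lie_algebra.galilean_transformations_normal) unfold_locales
  show "lie_group_iso galilean_group (symmetry_group \<gamma>\<lparr>carrier := galilean_transformations\<rparr>) galilean_action"
    unfolding lie_group_iso_def
    using galilean_action_iso smooth_on_subset[OF galilean_action_smooth] galilean_action_smooth_inverse
    by blast
  show "\<forall>A\<in>carrier galilean_group. \<forall>m. homogeneous (fst (galilean_action A m)) = A *v homogeneous (fst m)"
    by (auto simp: galilean_group_def galilean_action_matrix homogeneous_galilei)
qed

end
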